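(* Let $a_c'>b_c'>0$ and $-b_c'^2<k_1<0$, and let $\mathcal H_1$ be the one-sheeted hyperboloid $\frac{x^2}{a_{h_1}^2}+\frac{y^2}{b_{h_1}^2}-\frac{z^2}{c_{h_1}^2}=1$ with $a_{h_1}=\sqrt{a_c'^2+k_1}$, $b_{h_1}=\sqrt{b_c'^2+k_1}$, $c_{h_1}=\sqrt{-k_1}$. Let $\mathrm{sn},\mathrm{cn},\mathrm{dn}$ be the Jacobian elliptic functions to the modulus $m=\sqrt{a_c'^2-b_c'^2}/a_c'$ and $K=\int_0^{\pi/2}\frac{d\varphi}{\sqrt{1-m^2\sin^2\varphi}}$. Then, for either fixed choice of the sign $\pm$, the mapping $$\mathbf Z: U\times V\to\mathcal H_1,\quad (\tilde u,\tilde v)\mapsto\left(-a_{h_1}\frac{\mathrm{sn}\,\tilde u\,\mathrm{dn}\,\tilde v}{\mathrm{cn}\,\tilde v},\ b_{h_1}\frac{\mathrm{cn}\,\tilde u}{\mathrm{cn}\,\tilde v},\ \pm c_{h_1}\frac{\mathrm{dn}\,\tilde u\,\mathrm{sn}\,\tilde v}{\mathrm{cn}\,\tilde v}\right)$$ with $U=\{\tilde u\mid -K\le\tilde u<3K\}$ and $V=\{\tilde v\mid -K\le\tilde v<K\}$ is injective and parametrizes $\mathcal H_1$ in such a way that the lines $\tilde u=\mathrm{const.}$ are branches of the lines of curvature with $k_2=\mathrm{const.}$; along $\tilde v=\mathrm{const.}$ we have $k_0=\mathrm{const.}$; and $\tilde u\pm\tilde v=\mathrm{const.}$ defines generators of $\mathcal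 H_1$.
   Context: Confocal family: $\frac{x^2}{a_c'^2+k}+\frac{y^2}{b_c'^2+k}+\frac{z^2}{k}=1$. Through each point $(x,y,z)$ with $xyz\ne0$ pass exactly three quadrics of the family, with parameters (elliptic coordinates) $k_0>0$ (ellipsoid), $-b_c'^2<k_1<0$ (one-sheeted hyperboloid), $-a_c'^2<k_2<-b_c'^2$ (two-sheeted hyperboloid); on the coordinate planes $k_0,k_2$ are understood as limits (values $0$, $-b_c'^2$, $-a_c'^2$ may occur). The curves $k_0=\mathrm{const.}$ and $k_2=\mathrm{const.}$ on $\mathcal H_1$ are its lines of curvature. Generators of $\mathcal H_1$ are the straight lines contained in it. For $\tilde v=-K$, where $\mathrm{cn}\,\tilde v=0$, the image is to be understood as the point at infinity of (the projective closure of) $\mathcal H_1$ with homogeneous direction $(-a_{h_1}\mathrm{sn}\,\tilde u\,\mathrm{dn}\,\tilde v: b_{h_1}\mathrm{cn}\,\tilde u:\pm c_{h_1}\mathrm{dn}\,\tilde u\,\mathrm{sn}\,\tilde v)$; finite points correspond to $-K<\tilde v<K$. Lines $\tilde u\pm\tilde v=\mathrm{const.}$ are taken with $\tilde u$ modulo $4K$. *)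

theory Defs
  imports "HOL-Analysis.Analysis"
begin

text \<open>Jacobian elliptic functions with real argument, to the modulus \<^term>\<open>m::real\<close>
  (not the parameter \<^term>\<open>(m::real)^2\<close>), for \<open>0 < m < 1\<close>. The interval integral is signed, so
  \<open>ell_F m\<close> is an increasing bijection of the real line and its inverse is the amplitude.\<close>

definition ell_F :: "real \<Rightarrow> real \<Rightarrow> real" where
  "ell_F m \<phi> = (LBINT t=0..\<phi>. 1 / sqrt (1 - m^2 * (sin t)^2))"

definition ell_K :: "real \<Rightarrow> real" where
  "ell_K m = ell_F m (pi / 2)"

definition jacobi_am :: "real \<Rightarrow> real \<Rightarrow> real" where
  "jacobi_am m u = (THE \<phi>. ell_F m \<phi> = u)"

definition jacobi_sn :: "real \<Rightarrow> real \<Rightarrow> real" where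
  "jacobi_sn m u = sin (jacobi_am m u)"

definition jacobi_cn :: "real \<Rightarrow> real \<Rightarrow> real" where
  "jacobi_cn m u = cos (jacobi_am m u)"

definition jacobi_dn :: "real \<Rightarrow> real \<Rightarrow> real" where
  "jacobi_dn m u = sqrt (1 - m^2 * (jacobi_sn m u)^2)"

text \<open>Points of the real projective 3-space are the one-dimensional subspaces of
  \<open>(real^3) \<times> real\<close>; the last component is the homogenizing coordinate.\<close>

type_synonym proj_point = "((real^3) \<times> real) set"

definition finite_point :: "real^3 \<Rightarrow> proj_point" where
  "finite_point p = span {(p, 1)}"

definition ideal_point :: "real^3 \<Rightarrow> proj_point" where
  "ideal_point d = span {(d, 0)}"

definition hyperboloid :: "real \<Rightarrow> real \<Rightarrow> real \<Rightarrow> (real^3) set" where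
  "hyperboloid a b c = {p. (p$1)^2 / a^2 + (p$2)^2 / b^2 - (p$3)^2 / c^2 = 1}"

definition hyperboloid_closure :: "real \<Rightarrow> real \<Rightarrow> real \<Rightarrow> proj_point set" where
  "hyperboloid_closure a b c =
     {span {(p, w)} | p w. (p, w) \<noteq> 0 \<and> (p$1)^2 / a^2 + (p$2)^2 / b^2 - (p$3)^2 / c^2 = w^2}"

definition generator_closure :: "real \<Rightarrow> real \<Rightarrow> real \<Rightarrow> proj_point set \<Rightarrow> bool" where
  "generator_closure a b c L \<longleftrightarrow>
     (\<exists>p d. d \<noteq> 0 \<and> (\<forall>t. p + t *\<^sub>R d \<in> hyperboloid a b c) \<and>
        L = range (\<lambda>t. finite_point (p + t *\<^sub>R d)) \<union> {ideal_point d})"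

definition confocal_quadric :: "real \<Rightarrow> real \<Rightarrow> real \<Rightarrow> (real^3) set" where
  "confocal_quadric a b k = {p. (p$1)^2 / (a^2 + k) + (p$2)^2 / (b^2 + k) + (p$3)^2 / k = 1}"

text \<open>The parameters of the ellipsoid and of the two-sheeted hyperboloid through a point off the
  coordinate planes; meaningful only for such points.\<close>

definition ellipsoid_param :: "real \<Rightarrow> real \<Rightarrow> real^3 \<Rightarrow> real" where
  "ellipsoid_param a b p = (THE k. k > 0 \<and> p \<in> confocal_quadric a b k)"

definition two_sheeted_param :: "real \<Rightarrow> real \<Rightarrow> real^3 \<Rightarrow> real" where
  "two_sheeted_param a b p = (THE k. - (a^2) < k \<and> k < - (b^2) \<and> p \<in> confocal_quadric a b k)"

text \<open>\<open>limit_value f P l\<close>: extension of \<open>f\<close> from the finite points off the coordinate planes to all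
  projective points \<open>P\<close> by limits, computed in homogeneous coordinates. The filter does not exclude
  \<open>h\<close> itself, so at a finite point off the coordinate planes \<open>l\<close> is forced to be the value of \<open>f\<close>.
  The domain is dense, so \<open>l\<close> is unique. As a relation it fails, instead of returning
  an unspecified value, when there is no limit.\<close>

definition limit_value :: "(real^3 \<Rightarrow> real) \<Rightarrow> proj_point \<Rightarrow> ereal \<Rightarrow> bool" where
  "limit_value f P l \<longleftrightarrow>
     (\<forall>h \<in> P - {0}. ((\<lambda>(p, w). ereal (f (p /\<^sub>R w))) \<longlongrightarrow> l)
        (inf (nhds h) (principal {(p, w). w \<noteq> 0 \<and> p$1 \<noteq> 0 \<and> p$2 \<noteq> 0 \<and> p$3 \<noteq> 0})))"

definition has_k0 :: "real \<Rightarrow> real \<Rightarrow> proj_point \<Rightarrow> ereal \<Rightarrow> bool" where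
  "has_k0 a b = limit_value (ellipsoid_param a b)"

definition has_k2 :: "real \<Rightarrow> real \<Rightarrow> proj_point \<Rightarrow> ereal \<Rightarrow> bool" where
  "has_k2 a b = limit_value (two_sheeted_param a b)"

definition hyperboloid_normal :: "real \<Rightarrow> real \<Rightarrow> real \<Rightarrow> real^3 \<Rightarrow> real^3" where
  "hyperboloid_normal a b c p = sgn (vector [p$1 / a^2, p$2 / b^2, - (p$3 / c^2)])"

text \<open>A regular curve on the hyperboloid whose tangents are principal directions, i.e. the unit
  normal \<open>n\<close> satisfies \<open>dn = \<mu> d\<gamma>\<close> along the curve.\<close>

definition line_of_curvature ::
    "real \<Rightarrow> real \<Rightarrow> real \<Rightarrow> (real \<Rightarrow> real^3) \<Rightarrow> real set \<Rightarrow> bool" where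
  "line_of_curvature a b c \<gamma> I \<longleftrightarrow>
     (\<forall>t\<in>I. \<gamma> t \<in> hyperboloid a b c \<and>
        (\<exists>\<gamma>' \<mu>. \<gamma>' \<noteq> 0 \<and> (\<gamma> has_vector_derivative \<gamma>') (at t) \<and>
           ((\<lambda>x. hyperboloid_normal a b c (\<gamma> x)) has_vector_derivative \<mu> *\<^sub>R \<gamma>') (at t)))"

definition Z_affine ::
    "real \<Rightarrow> real \<Rightarrow> real \<Rightarrow> real \<Rightarrow> real \<Rightarrow> real \<Rightarrow> real \<Rightarrow> real^3" where
  "Z_affine a b c m s u v = vector
     [- a * (jacobi_sn m u * jacobi_dn m v / jacobi_cn m v),
      b * (jacobi_cn m u / jacobi_cn m v),
      s * c * (jacobi_dn m u * jacobi_sn m v / jacobi_cn m v)]"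

definition Z_ideal_direction ::
    "real \<Rightarrow> real \<Rightarrow> real \<Rightarrow> real \<Rightarrow> real \<Rightarrow> real \<Rightarrow> real \<Rightarrow> real^3" where
  "Z_ideal_direction a b c m s u v = vector
     [- a * (jacobi_sn m u * jacobi_dn m v),
      b * jacobi_cn m u,
      s * c * (jacobi_dn m u * jacobi_sn m v)]"

definition Z_map ::
    "real \<Rightarrow> real \<Rightarrow> real \<Rightarrow> real \<Rightarrow> real \<Rightarrow> real \<times> real \<Rightarrow> proj_point" where
  "Z_map a b c m s = (\<lambda>(u, v).
     if jacobi_cn m v = 0 then ideal_point (Z_ideal_direction a b c m s u v)
     else finite_point (Z_affine a b c m s u v))"

end

theory Submission
  imports Defs
begin

text \<open>In homogeneous coordinates \<open>Z(u, v)\<close> is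
  \<open>h = (- a sn u dn v, b cn u, \<plusminus> c dn u sn v, cn v)\<close>, for finite and ideal points alike. Clearing
  denominators in the confocal equation at \<open>h\<close> gives a cubic in \<open>k\<close> that splits as
  \<open>(k - k1) (k + a_c\<^sup>2 dn\<^sup>2 u) (k cn\<^sup>2 v - b_c\<^sup>2 sn\<^sup>2 v)\<close>. Hence \<open>k2 = - a_c\<^sup>2 dn\<^sup>2 u\<close> depends only on \<open>u\<close> and
  \<open>k0 = b_c\<^sup>2 sn\<^sup>2 v / cn\<^sup>2 v\<close> only on \<open>v\<close>. As the sign of the cubic at a fixed \<open>k\<close> tells on which side
  of \<open>k\<close> the parameters lie and is stable under perturbation of \<open>h\<close>, these values are also the limits
  on the coordinate planes and at infinity.
  With \<open>q = u \<plusminus> v\<close>, the addition theorems amount to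
  \<open>h = cn v \<cdot> (p, 1) \<plusminus> dn u sn v \<cdot> (d, 0)\<close>, where \<open>p\<close> and \<open>d\<close> depend on \<open>q\<close> only; this is the
  generator.\<close>

section \<open>Vectors, one-dimensional spans and monic cubics\<close>

lemma has_vector_derivative_vector3:
  assumes "(f has_real_derivative f') (at x within S)" "(g has_real_derivative g') (at x within S)" "(h has_real_derivative h') (at x within S)"
  shows "((\<lambda>t. vector [f t, g t, h t] :: real^3) has_vector_derivative vector [f', g', h']) (at x within S)"
proof -
  have eq: "(vector [x, y, z] :: real^3) = x *\<^sub>R axis 1 1 + y *\<^sub>R axis 2 1 + z *\<^sub>R axis 3 1" for x y z :: real
    by (simp add: vec_eq_iff forall_3 axis_def)
  have scale: "((\<lambda>t. k t *\<^sub>R e) has_vector_derivative k' *\<^sub>R e) (at x within S)"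
    if "(k has_real_derivative k') (at x within S)" for k k' and e :: "real^3"
    using has_vector_derivative_scaleR[OF that has_vector_derivative_const[of e]] by simp
  then show ?thesis unfolding eq by (intro has_vector_derivative_add scale assms)
qed

lemma norm_vector3: "norm (vector [x, y, z] :: real^3) = sqrt (x\<^sup>2 + y\<^sup>2 + z\<^sup>2)"
  by (simp add: norm_vec_def L2_set_def sum_3)

lemma span_singleton_scaleR:
  fixes x :: "'a :: real_vector"
  assumes "r \<noteq> 0"
  shows "span {r *\<^sub>R x} = span {x}"
proof -
  have "y \<in> range (\<lambda>k. k *\<^sub>R r *\<^sub>R x) \<longleftrightarrow> y \<in> range (\<lambda>k. k *\<^sub>R x)" for y
  proof
    assume "y \<in> range (\<lambda>k. k *\<^sub>R x)"
    then obtain k where "y = (k / r) *\<^sub>R r *\<^sub>R x" using assms by auto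
    then show "y \<in> range (\<lambda>k. k *\<^sub>R r *\<^sub>R x)" by blast
  qed auto
  then show ?thesis by (auto simp: span_singleton)
qed

lemma span_singleton_eqE:
  fixes x y :: "'a :: real_vector"
  assumes "span {x} = span {y}" "x \<noteq> 0"
  obtains r where "r \<noteq> 0" "x = r *\<^sub>R y"
proof -
  have "x \<in> span {y}" using assms(1) span_base by blast
  then obtain r where "x = r *\<^sub>R y" by (auto simp: span_singleton)
  with that assms(2) show thesis by auto
qed

text \<open>Divided differences: subtracting two of the equations and cancelling the difference of
  the roots lowers the degree. Doing this twice leaves Vieta's relation
  \<open>x + y + z + p = 0\<close>, from which the other coefficients follow.\<close>

lemma monic_cubic_eq_prod_roots:
  fixes p q r x y z k :: real
  assumes "x \<noteq> y" "y \<noteq> z" "x \<noteq> z"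
    and "x^3 + p * x\<^sup>2 + q * x + r = 0" "y^3 + p * y\<^sup>2 + q * y + r = 0" "z^3 + p * z\<^sup>2 + q * z + r = 0"
  shows "k^3 + p * k\<^sup>2 + q * k + r = (k - x) * (k - y) * (k - z)"
proof -
  have "(x - y) * (x\<^sup>2 + x * y + y\<^sup>2 + p * (x + y) + q) = 0"
       "(x - z) * (x\<^sup>2 + x * z + z\<^sup>2 + p * (x + z) + q) = 0"
    using assms(4-6) by algebra+
  then have 1: "x\<^sup>2 + x * y + y\<^sup>2 + p * (x + y) + q = 0"
      and 2: "x\<^sup>2 + x * z + z\<^sup>2 + p * (x + z) + q = 0" using assms by auto
  then have "(y - z) * (x + y + z + p) = 0" by algebra
  then have "x + y + z + p = 0" using assms by auto
  with 1 assms(4) show ?thesis by algebra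
qed

section \<open>Jacobian elliptic functions\<close>

locale elliptic_modulus =
  fixes m :: real
  assumes modulus: "m\<^sup>2 < 1"
begin

abbreviation "F \<equiv> ell_F m"
abbreviation "K \<equiv> ell_K m"
abbreviation "am \<equiv> jacobi_am m"
abbreviation "sn \<equiv> jacobi_sn m"
abbreviation "cn \<equiv> jacobi_cn m"
abbreviation "dn \<equiv> jacobi_dn m"

section \<open>The elliptic integral and the amplitude\<close>

lemma radicand_pos: "y\<^sup>2 \<le> 1 \<Longrightarrow> 0 < 1 - m\<^sup>2 * y\<^sup>2"
proof -
  assume "y\<^sup>2 \<le> 1"
  then have "m\<^sup>2 * y\<^sup>2 \<le> m\<^sup>2" by (simp add: mult_left_le)
  then show ?thesis using modulus by linarith
qed

lemma radicand_sin_pos: "0 < 1 - m\<^sup>2 * (sin t)\<^sup>2"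
  by (rule radicand_pos) (simp add: abs_square_le_1)

lemma F_deriv: "(F has_real_derivative 1 / sqrt (1 - m\<^sup>2 * (sin x)\<^sup>2)) (at x)"
proof -
  let ?f = "\<lambda>t. 1 / sqrt (1 - m\<^sup>2 * (sin t)\<^sup>2)"
  \<comment> \<open>The radius exceeds the absolute value of \<open>x\<close>, so \<open>x\<close>
    is an interior point and the derivative within the interval is the full derivative.\<close>
  let ?b = "\<bar>x\<bar> + 1"
  have c: "continuous_on {-?b..?b} ?f"
    using radicand_sin_pos by (intro continuous_intros) (metis less_irrefl real_sqrt_eq_zero_cancel_iff)
  have "((\<lambda>u. LBINT y=0..u. ?f y) has_vector_derivative ?f x) (at x within {-?b..?b})"
    using interval_integral_FTC2[of "-?b" 0 "?b" ?f x, OF _ _ c] by (simp add: zero_ereal_def)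
  moreover have "at x within {-?b..?b} = at x"
    by (rule at_within_interior) (auto simp: abs_if)
  ultimately show ?thesis
    unfolding ell_F_def has_real_derivative_iff_has_vector_derivative by simp
qed

lemma F_0 [simp]: "F 0 = 0"
  by (simp add: ell_F_def zero_ereal_def)

lemma F_slope: "1 \<le> 1 / sqrt (1 - m\<^sup>2 * (sin x)\<^sup>2)"
  using radicand_sin_pos[of x] by simp

text \<open>The integrand is at least 1, so \<open>F x - x\<close> is nondecreasing. This linear
  growth gives strict monotonicity and surjectivity of \<open>F\<close>, and so the inverse
  \<open>am\<close>.\<close>

lemma F_diff_mono: "x \<le> y \<Longrightarrow> y - x \<le> F y - F x"
proof -
  assume "x \<le> y"
  then have "F x - x \<le> F y - y"
    by (rule DERIV_nonneg_imp_nondecreasing)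
      (use F_slope in \<open>fastforce intro!: derivative_eq_intros F_deriv\<close>)
  then show ?thesis by simp
qed

lemma F_strict_mono: "strict_mono F"
proof (rule strict_monoI)
  fix x y :: real assume "x < y"
  then show "F x < F y" using F_diff_mono[of x y] by linarith
qed

lemma isCont_F: "isCont F x"
  using F_deriv DERIV_isCont by blast

lemma F_surj: "\<exists>x. F x = u"
proof -
  have "F (- \<bar>u\<bar>) \<le> u" "u \<le> F \<bar>u\<bar>"
    using F_diff_mono[of "- \<bar>u\<bar>" 0] F_diff_mono[of 0 "\<bar>u\<bar>"] by auto
  then show ?thesis
    using IVT[of F "- \<bar>u\<bar>" u "\<bar>u\<bar>"] isCont_F by auto
qed

lemma F_am [simp]: "F (am u) = u"
  unfolding jacobi_am_def
  by (rule theI') (metis F_surj F_strict_mono strict_mono_eq)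

lemma am_F [simp]: "am (F x) = x"
  using F_am F_strict_mono strict_mono_eq by blast

lemma am_less_iff [simp]: "am u < am v \<longleftrightarrow> u < v"
  using F_strict_mono strict_mono_less[of F "am u" "am v"] by simp

text \<open>The integrand is even, so \<open>F x + F (- x)\<close> has derivative 0 and keeps its
  value at 0.\<close>

lemma F_minus: "F (- x) = - F x"
proof -
  have "((\<lambda>x. F x + F (- x)) has_real_derivative 0) (at x)" for x
    by (auto intro!: derivative_eq_intros DERIV_chain2[where f = F, OF F_deriv])
  then have "F x + F (- x) = F 0 + F (- 0)"
    using DERIV_isconst_all by blast
  then show ?thesis by simp
qed

lemma F_add_pi: "F (x + pi) = F x + 2 * K"
proof -
  have "((\<lambda>x. F (x + pi) - F x) has_real_derivative 0) (at x)" for x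
    by (auto intro!: derivative_eq_intros F_deriv DERIV_chain2[where f = F, OF F_deriv])
  \<comment> \<open>The constant difference is evaluated at \<open>- (pi / 2)\<close>, where oddness
    of \<open>F\<close> turns it into \<open>F (pi / 2) + F (pi / 2)\<close>.\<close>
  then have "F (x + pi) - F x = F (- (pi / 2) + pi) - F (- (pi / 2))"
    using DERIV_isconst_all by blast
  then show ?thesis by (simp add: F_minus ell_K_def)
qed

lemma K_pos: "0 < K"
  using F_strict_mono strict_monoD[of F 0 "pi / 2"] by (simp add: ell_K_def)

lemma am_0 [simp]: "am 0 = 0"
  using am_F[of 0] by simp

lemma am_K [simp]: "am K = pi / 2"
  by (simp add: ell_K_def)

lemma am_minus [simp]: "am (- u) = - am u"
  by (metis F_am F_minus am_F)

lemma am_add_2K: "am (u + 2 * K) = am u + pi"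
  by (metis F_add_pi F_am am_F)

lemma am_add_4K: "am (u + 4 * K) = am u + 2 * pi"
  using am_add_2K[of "u + 2 * K"] am_add_2K[of u] by (simp add: algebra_simps)

lemma am_add_4K_nat: "am (u + 4 * K * of_nat n) = am u + 2 * pi * of_nat n"
proof (induction n)
  case (Suc n)
  then show ?case using am_add_4K[of "u + 4 * K * of_nat n"] by (simp add: algebra_simps)
qed simp

lemma am_add_4K_int: "am (u + 4 * K * of_int n) = am u + 2 * pi * of_int n"
proof (cases n rule: int_cases2)
  case (nonneg k)
  then show ?thesis using am_add_4K_nat by simp
next
  case (nonpos k)
  then show ?thesis using am_add_4K_nat[of "u + 4 * K * of_int n" k] by simp
qed

section \<open>Identities and derivatives of sn, cn and dn\<close>

lemma sn_cn_sq: "(cn u)\<^sup>2 = 1 - (sn u)\<^sup>2"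
  by (simp add: jacobi_sn_def jacobi_cn_def cos_squared_eq)

lemma sn_sq_le_1: "(sn u)\<^sup>2 \<le> 1"
  by (simp add: jacobi_sn_def abs_square_le_1)

lemma dn_sq: "(dn u)\<^sup>2 = 1 - m\<^sup>2 * (sn u)\<^sup>2"
  unfolding jacobi_dn_def using radicand_pos[OF sn_sq_le_1[of u]] by simp

lemma dn_pos: "0 < dn u"
  unfolding jacobi_dn_def using radicand_pos[OF sn_sq_le_1[of u]] by simp

lemma sn_0 [simp]: "sn 0 = 0" and cn_0 [simp]: "cn 0 = 1" and dn_0 [simp]: "dn 0 = 1"
  by (simp_all add: jacobi_sn_def jacobi_cn_def jacobi_dn_def)

lemma sn_minus [simp]: "sn (- u) = - sn u" and cn_minus [simp]: "cn (- u) = cn u"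
  and dn_minus [simp]: "dn (- u) = dn u"
  by (simp_all add: jacobi_sn_def jacobi_cn_def jacobi_dn_def)

lemma isCont_am: "isCont am u"
  using isCont_inverse_function[of 1 "am u" am F] isCont_F by simp

lemma am_deriv: "(am has_real_derivative dn u) (at u)"
proof -
  have "(am has_real_derivative inverse (1 / sqrt (1 - m\<^sup>2 * (sin (am u))\<^sup>2))) (at u)"
    by (rule DERIV_inverse_function[where f = F and a = "u - 1" and b = "u + 1"])
      (use F_deriv[of "am u"] radicand_sin_pos[of "am u"] isCont_am in auto)
  then show ?thesis by (simp add: jacobi_dn_def jacobi_sn_def)
qed

lemma sn_deriv: "(sn has_real_derivative cn u * dn u) (at u)"
proof -
  have "((\<lambda>u. sin (am u)) has_real_derivative cos (am u) * dn u) (at u)"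
    by (auto intro!: derivative_eq_intros am_deriv)
  then show ?thesis by (simp add: jacobi_sn_def[abs_def] jacobi_cn_def)
qed

lemma cn_deriv: "(cn has_real_derivative - (sn u * dn u)) (at u)"
proof -
  have "((\<lambda>u. cos (am u)) has_real_derivative - (sin (am u) * dn u)) (at u)"
    by (auto intro!: derivative_eq_intros am_deriv)
  then show ?thesis by (simp add: jacobi_sn_def jacobi_cn_def[abs_def])
qed

lemma dn_deriv: "(dn has_real_derivative - (m\<^sup>2 * sn u * cn u)) (at u)"
proof -
  have "((\<lambda>u. sqrt (1 - m\<^sup>2 * (sn u)\<^sup>2)) has_real_derivative - (m\<^sup>2 * sn u * cn u)) (at u)"
    using radicand_pos[OF sn_sq_le_1[of u]] dn_pos[of u]
    by (auto intro!: derivative_eq_intros sn_deriv simp: jacobi_dn_def divide_simps)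
  then show ?thesis by (simp add: jacobi_dn_def[abs_def])
qed

lemmas jacobi_derivs_chain [derivative_intros] = sn_deriv [THEN DERIV_chain2]
  cn_deriv [THEN DERIV_chain2] dn_deriv [THEN DERIV_chain2]

section \<open>Addition theorems\<close>

lemma add_denom_pos: "0 < 1 - m\<^sup>2 * (sn u)\<^sup>2 * (sn v)\<^sup>2"
proof -
  have "(sn u * sn v)\<^sup>2 \<le> 1"
    using sn_sq_le_1[of u] sn_sq_le_1[of v] by (simp add: power_mult_distrib mult_le_one)
  from radicand_pos[OF this] show ?thesis by (simp add: power_mult_distrib mult.assoc)
qed

text \<open>Both sides agree at \<open>v = 0\<close>, and the derivative of the right-hand side along
  \<open>u + v = const\<close> vanishes.\<close>

lemma sn_add: "sn (u + v) = (sn u * cn v * dn v + sn v * cn u * dn u) / (1 - m\<^sup>2 * (sn u)\<^sup>2 * (sn v)\<^sup>2)"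
  and cn_add: "cn (u + v) = (cn u * cn v - sn u * sn v * dn u * dn v) / (1 - m\<^sup>2 * (sn u)\<^sup>2 * (sn v)\<^sup>2)"
proof -
  define q where "q = u + v"
  let ?D = "\<lambda>t. 1 - m\<^sup>2 * (sn (q - t))\<^sup>2 * (sn t)\<^sup>2"
  let ?S = "\<lambda>t. sn (q - t) * cn t * dn t + sn t * cn (q - t) * dn (q - t)"
  let ?C = "\<lambda>t. cn (q - t) * cn t - sn (q - t) * sn t * dn (q - t) * dn t"
  have "((\<lambda>t. ?S t / ?D t) has_real_derivative 0) (at t) \<and>
        ((\<lambda>t. ?C t / ?D t) has_real_derivative 0) (at t)" for t
  proof -
    let ?p = "q - t"
    have D: "?D t \<noteq> 0" using add_denom_pos[of ?p t] by simp
    note eqs = sn_cn_sq[of t] sn_cn_sq[of ?p] dn_sq[of t] dn_sq[of ?p]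
    \<comment> \<open>Closed forms of the derivatives of \<open>?S\<close>, \<open>?C\<close> and
      \<open>?D\<close>; the first two are reduced by the relations \<open>eqs\<close>. The
      numerators of the quotient rule then vanish modulo these relations.\<close>
    define S' where "S' = 2 * m\<^sup>2 * sn ?p * sn t * ((sn t)\<^sup>2 - (sn ?p)\<^sup>2)"
    define C' where "C' = 2 * m\<^sup>2 * sn ?p * sn t * (dn ?p * cn t * sn t - sn ?p * cn ?p * dn t)"
    define D' where "D' = - 2 * m\<^sup>2 * sn ?p * sn t * (sn ?p * cn t * dn t - sn t * cn ?p * dn ?p)"
    have dS: "(?S has_real_derivative S') (at t)"
      apply (rule derivative_eq_intros refl)+
      using eqs unfolding S'_def by algebra
    have dC: "(?C has_real_derivative C') (at t)"
      apply (rule derivative_eq_intros refl)+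
      using eqs unfolding C'_def by algebra
    have dD: "(?D has_real_derivative D') (at t)"
      apply (rule derivative_eq_intros refl)+
      unfolding D'_def by (simp add: algebra_simps power2_eq_square)
    have "S' * ?D t - ?S t * D' = 0" "C' * ?D t - ?C t * D' = 0"
      using eqs unfolding S'_def C'_def D'_def by algebra+
    then show ?thesis
      using DERIV_divide[OF dS dD D] DERIV_divide[OF dC dD D] by simp
  qed
  then have "?S v / ?D v = ?S 0 / ?D 0" "?C v / ?D v = ?C 0 / ?D 0"
    using DERIV_isconst_all by blast+
  then show "sn (u + v) = (sn u * cn v * dn v + sn v * cn u * dn u) / (1 - m\<^sup>2 * (sn u)\<^sup>2 * (sn v)\<^sup>2)"
    and "cn (u + v) = (cn u * cn v - sn u * sn v * dn u * dn v) / (1 - m\<^sup>2 * (sn u)\<^sup>2 * (sn v)\<^sup>2)"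
    by (simp_all add: q_def)
qed

section \<open>Periods, signs and prescribed values\<close>

lemma period_4K:
  shows "sn (u + 4 * K * of_int n) = sn u" and "cn (u + 4 * K * of_int n) = cn u"
    and "dn (u + 4 * K * of_int n) = dn u"
proof -
  show sn: "sn (u + 4 * K * of_int n) = sn u" and "cn (u + 4 * K * of_int n) = cn u"
    using sin_cos_eq_iff[of "am u + 2 * pi * of_int n" "am u"]
    by (auto simp: jacobi_sn_def jacobi_cn_def am_add_4K_int)
  show "dn (u + 4 * K * of_int n) = dn u"
    by (simp add: jacobi_dn_def sn)
qed

text \<open>\<open>(cn u, sn u)\<close> is the point of the unit circle at angle
  \<open>am u\<close>, and a full turn of \<open>am u\<close> corresponds to \<open>4 * K\<close> in
  \<open>u\<close>.\<close>

lemma sn_cn_eq_iff: "sn u = sn v \<and> cn u = cn v \<longleftrightarrow> (\<exists>n::int. u = v + 4 * K * of_int n)"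
proof
  assume "sn u = sn v \<and> cn u = cn v"
  then obtain n :: int where "am u = am v + 2 * pi * of_int n"
    using sin_cos_eq_iff[of "am u" "am v"] by (auto simp: jacobi_sn_def jacobi_cn_def)
  then have "am u = am (v + 4 * K * of_int n)" by (simp add: am_add_4K_int)
  then have "F (am u) = F (am (v + 4 * K * of_int n))" by (rule arg_cong)
  then show "\<exists>n::int. u = v + 4 * K * of_int n" by auto
qed (auto simp: period_4K)

lemma ex_reduced_argument: "\<exists>n::int. x + 4 * K * of_int n \<in> {- K..<3 * K}"
proof -
  define n where "n = - \<lfloor>(x + K) / (4 * K)\<rfloor>"
  have "real_of_int (- n) \<le> (x + K) / (4 * K)" "(x + K) / (4 * K) < real_of_int (- n) + 1"
    unfolding n_def by linarith+
  then have "x + 4 * K * of_int n \<in> {- K..<3 * K}"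
    using K_pos by (simp add: field_simps)
  then show ?thesis ..
qed

lemma reduced_argument_unique:
  assumes "u \<in> {- K..<3 * K}" "v \<in> {- K..<3 * K}" "sn u = sn v" "cn u = cn v"
  shows "u = v"
proof -
  obtain n :: int where n: "u = v + 4 * K * of_int n" using sn_cn_eq_iff assms by blast
  then have "\<bar>4 * K * of_int n\<bar> < 4 * K * 1" using assms(1,2) by auto
  then have "\<bar>of_int n :: real\<bar> < 1" using K_pos by (simp add: abs_mult)
  then have "n = 0" by linarith
  then show ?thesis using n by simp
qed

lemma ex_sn_cn:
  assumes "x\<^sup>2 + y\<^sup>2 = 1"
  obtains u where "u \<in> {- K..<3 * K}" "cn u = x" "sn u = y"
proof -
  obtain t where t: "x = cos t" "y = sin t" using sincos_total_2pi assms by metis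
  obtain n :: int where n: "F t + 4 * K * of_int n \<in> {- K..<3 * K}"
    using ex_reduced_argument by blast
  have "cn (F t + 4 * K * of_int n) = x" "sn (F t + 4 * K * of_int n) = y"
    by (simp_all add: period_4K) (simp_all add: t jacobi_sn_def jacobi_cn_def)
  with n that show thesis by blast
qed

lemma cn_pos: "- K < v \<Longrightarrow> v < K \<Longrightarrow> 0 < cn v"
  unfolding jacobi_cn_def by (rule cos_gt_zero_pi) (metis am_less_iff am_K am_minus)+

lemma sn_K [simp]: "sn K = 1" and cn_K [simp]: "cn K = 0"
  by (simp_all add: jacobi_sn_def jacobi_cn_def)

lemma cn_neg: "K < v \<Longrightarrow> v < 3 * K \<Longrightarrow> cn v < 0"
proof -
  assume "K < v" "v < 3 * K"
  then have "0 < cn (v + 2 * (- K))" by (intro cn_pos) auto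
  moreover have "am v = am (v + 2 * (- K)) + pi" using am_add_2K[of "v + 2 * (- K)"] by simp
  ultimately show ?thesis by (simp add: jacobi_cn_def)
qed

text \<open>Both \<open>- K\<close> and \<open>K\<close> are zeros of \<open>cn\<close>. The
  half-open interval keeps only \<open>- K\<close>, and the two are told apart by the value of
  \<open>sn\<close>, which is \<open>- 1\<close> against \<open>1\<close>.\<close>

lemma cn_nonneg_reduced:
  assumes "v \<in> {- K..<3 * K}" "0 \<le> cn v" "cn v = 0 \<Longrightarrow> sn v = - 1"
  shows "v \<in> {- K..<K}"
proof -
  have "v \<noteq> K" using assms by auto
  then show ?thesis using assms cn_neg[of v] by force
qed

lemma
  assumes "v \<in> {- K..<K}"
  shows cn_nonneg: "0 \<le> cn v" and cn_eq_0_iff: "cn v = 0 \<longleftrightarrow> v = - K"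
  using assms cn_pos[of v] by (cases "v = - K"; force)+

text \<open>The addition theorems solved for \<open>sn u * dn v\<close> and \<open>cn u\<close>,
  after multiplication by their common denominator. The coefficients \<open>cn v\<close> and
  \<open>dn u * sn v\<close> now multiply functions of \<open>u + v\<close> alone, which later
  expresses that a point lies on a generator.\<close>

lemma addition_linear:
  shows "sn u * dn v = cn v * sn (u + v) - dn u * sn v * cn (u + v)"
    and "cn u = cn v * cn (u + v) + dn u * sn v * sn (u + v)"
proof -
  let ?D = "1 - m\<^sup>2 * (sn u)\<^sup>2 * (sn v)\<^sup>2"
  have D: "?D \<noteq> 0" using add_denom_pos[of u v] by simp
  note eqs = sn_cn_sq[of u] sn_cn_sq[of v] dn_sq[of u] dn_sq[of v]
  have S: "sn (u + v) * ?D = sn u * cn v * dn v + sn v * cn u * dn u"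
    and C: "cn (u + v) * ?D = cn u * cn v - sn u * sn v * dn u * dn v"
    using D by (simp_all only: sn_add cn_add) simp_all
  have "(cn v * sn (u + v) - dn u * sn v * cn (u + v)) * ?D = cn v * (sn (u + v) * ?D) - dn u * sn v * (cn (u + v) * ?D)"
    by (simp add: algebra_simps)
  also have "\<dots> = (sn u * dn v) * ?D" unfolding S C using eqs by algebra
  finally show "sn u * dn v = cn v * sn (u + v) - dn u * sn v * cn (u + v)" using D by simp
  have "(cn v * cn (u + v) + dn u * sn v * sn (u + v)) * ?D = cn v * (cn (u + v) * ?D) + dn u * sn v * (sn (u + v) * ?D)"
    by (simp add: algebra_simps)
  also have "\<dots> = cn u * ?D" unfolding S C using eqs by algebra
  finally show "cn u = cn v * cn (u + v) + dn u * sn v * sn (u + v)" using D by simp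
qed

end

section \<open>Elliptic coordinates\<close>

text \<open>The homogenized confocal equation at \<open>h\<close>, multiplied by
  \<open>(a^2 + k) * (b^2 + k) * k\<close>. Being polynomial, it also makes sense at ideal points
  and for \<open>k\<close> equal to \<open>- a^2\<close>, \<open>- b^2\<close> or
  \<open>0\<close>.\<close>

definition confocal_poly :: "real \<Rightarrow> real \<Rightarrow> (real^3) \<times> real \<Rightarrow> real \<Rightarrow> real" where
  "confocal_poly a b h k = (snd h)\<^sup>2 * (a\<^sup>2 + k) * (b\<^sup>2 + k) * k - (fst h $ 1)\<^sup>2 * (b\<^sup>2 + k) * k
     - (fst h $ 2)\<^sup>2 * (a\<^sup>2 + k) * k - (fst h $ 3)\<^sup>2 * (a\<^sup>2 + k) * (b\<^sup>2 + k)"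

lemma confocal_poly_scaleR: "confocal_poly a b (r *\<^sub>R h) k = r\<^sup>2 * confocal_poly a b h k"
  by (simp add: confocal_poly_def algebra_simps)

lemma continuous_confocal_poly: "continuous_on UNIV (\<lambda>h. confocal_poly a b h k)"
  unfolding confocal_poly_def by (intro continuous_intros)

lemma mem_confocal_quadric_iff:
  assumes "a\<^sup>2 + k \<noteq> 0" "b\<^sup>2 + k \<noteq> 0" "k \<noteq> 0"
  shows "p \<in> confocal_quadric a b k \<longleftrightarrow> confocal_poly a b (p, 1) k = 0"
proof -
  have "confocal_poly a b (p, 1) k = (a\<^sup>2 + k) * (b\<^sup>2 + k) * k *
      (1 - ((p$1)\<^sup>2 / (a\<^sup>2 + k) + (p$2)\<^sup>2 / (b\<^sup>2 + k) + (p$3)\<^sup>2 / k))"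
  proof -
    have "\<alpha> * \<beta> * k * (1 - (x / \<alpha> + y / \<beta> + z / k)) = \<alpha> * \<beta> * k - x * \<beta> * k - y * \<alpha> * k - z * \<alpha> * \<beta>"
      if "\<alpha> \<noteq> 0" "\<beta> \<noteq> 0" for \<alpha> \<beta> x y z :: real
      using that assms(3) by (simp add: field_simps)
    then show ?thesis using assms(1,2) by (simp add: confocal_poly_def)
  qed
  then show ?thesis
    using assms by (auto simp: confocal_quadric_def)
qed

locale confocal_family =
  fixes a b :: real
  assumes b_pos: "0 < b" and b_less_a: "b < a"
begin

abbreviation "Q \<equiv> confocal_poly a b"

lemma sq_less: "b\<^sup>2 < a\<^sup>2" "0 < b\<^sup>2" "0 < a\<^sup>2"
  using b_pos b_less_a by (auto simp: power_strict_mono)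

text \<open>The cubic is negative at \<open>- a^2\<close>, positive at \<open>- b^2\<close>,
  negative at \<open>0\<close> and nonnegative at \<open>N\<close>, so each of the three gaps
  contains a root. Off the coordinate planes the first three signs are strict, which keeps the roots
  away from these three values.\<close>

lemma confocal_poly_factor:
  fixes p :: "real^3"
  assumes "p$1 \<noteq> 0" "p$2 \<noteq> 0" "p$3 \<noteq> 0"
  obtains k0 k1 k2 where "0 < k0" "- b\<^sup>2 < k1" "k1 < 0" "- a\<^sup>2 < k2" "k2 < - b\<^sup>2"
    "\<And>k. Q (p, 1) k = (k - k0) * (k - k1) * (k - k2)"
proof -
  define f where "f = Q (p, 1)"
  have cont: "isCont f k" for k unfolding f_def confocal_poly_def by (intro continuous_intros)
  \<comment> \<open>Upper end of the search interval for \<open>k0\<close>: at \<open>k = N\<close>,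
    writing the factor \<open>k\<close> of the leading term as the sum of the three squares cancels
    all negative terms.\<close>
  define N where "N = (p$1)\<^sup>2 + (p$2)\<^sup>2 + (p$3)\<^sup>2"
  have f0: "f 0 < 0" using assms sq_less by (simp add: f_def confocal_poly_def)
  have fb: "f (- b\<^sup>2) > 0" using assms sq_less by (simp add: f_def confocal_poly_def)
  have "f (- a\<^sup>2) = - ((p$1)\<^sup>2 * (a\<^sup>2 - b\<^sup>2) * a\<^sup>2)"
    by (simp add: f_def confocal_poly_def algebra_simps)
  then have fa: "f (- a\<^sup>2) < 0" using assms sq_less by simp
  have N: "0 \<le> N" by (simp add: N_def)
  have "f N = (p$1)\<^sup>2 * a\<^sup>2 * (b\<^sup>2 + N) + (p$2)\<^sup>2 * (a\<^sup>2 + N) * b\<^sup>2"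
    by (simp add: f_def confocal_poly_def N_def) algebra
  then have fN: "0 \<le> f N" using N by simp
  obtain k0 where k0: "0 \<le> k0" "f k0 = 0" using IVT[of f 0 0 N] f0 fN N cont by auto
  obtain k1 where k1: "- b\<^sup>2 \<le> k1" "k1 \<le> 0" "f k1 = 0"
    using IVT2[of f 0 0 "- b\<^sup>2"] f0 fb cont by auto
  obtain k2 where k2: "- a\<^sup>2 \<le> k2" "k2 \<le> - b\<^sup>2" "f k2 = 0"
    using IVT[of f "- a\<^sup>2" 0 "- b\<^sup>2"] fa fb sq_less cont by auto
  have ne: "k0 \<noteq> 0" "k1 \<noteq> 0" "k1 \<noteq> - b\<^sup>2" "k2 \<noteq> - b\<^sup>2" "k2 \<noteq> - a\<^sup>2"
    using f0 fb fa k0 k1 k2 by auto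
  define \<alpha> \<beta> \<gamma> where "\<alpha> = a\<^sup>2 + b\<^sup>2 - N"
    and "\<beta> = a\<^sup>2 * b\<^sup>2 - (p$1)\<^sup>2 * b\<^sup>2 - (p$2)\<^sup>2 * a\<^sup>2 - (p$3)\<^sup>2 * (a\<^sup>2 + b\<^sup>2)"
    and "\<gamma> = - ((p$3)\<^sup>2 * a\<^sup>2 * b\<^sup>2)"
  have f: "f k = k^3 + \<alpha> * k\<^sup>2 + \<beta> * k + \<gamma>" for k
    by (simp add: f_def confocal_poly_def N_def \<alpha>_def \<beta>_def \<gamma>_def) algebra
  have "f k = (k - k0) * (k - k1) * (k - k2)" for k
    unfolding f
    by (rule monic_cubic_eq_prod_roots) (use ne k0 k1 k2 sq_less in \<open>auto simp: f[symmetric]\<close>)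
  then show thesis using that[of k0 k1 k2] ne k0 k1 k2 by (auto simp: f_def)
qed

text \<open>The three roots lie in disjoint intervals, so exactly one is positive and exactly one
  lies between \<open>- a^2\<close> and \<open>- b^2\<close>. Hence both definite descriptions are
  proper and name roots of the cubic.\<close>

lemma params_eq:
  fixes p :: "real^3"
  assumes "p$1 \<noteq> 0" "p$2 \<noteq> 0" "p$3 \<noteq> 0"
  obtains k1 where "0 < ellipsoid_param a b p" "- b\<^sup>2 < k1" "k1 < 0"
    "- a\<^sup>2 < two_sheeted_param a b p" "two_sheeted_param a b p < - b\<^sup>2"
    "\<And>k. Q (p, 1) k = (k - ellipsoid_param a b p) * (k - k1) * (k - two_sheeted_param a b p)"
proof -
  obtain k0 k1 k2 where k: "0 < k0" "- b\<^sup>2 < k1" "k1 < 0" "- a\<^sup>2 < k2" "k2 < - b\<^sup>2"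
    and Q: "\<And>k. Q (p, 1) k = (k - k0) * (k - k1) * (k - k2)"
    using confocal_poly_factor[OF assms] by blast
  have "ellipsoid_param a b p = k0"
    unfolding ellipsoid_param_def
  proof (rule the_equality)
    fix x assume "0 < x \<and> p \<in> confocal_quadric a b x"
    then show "x = k0" using k Q[of x] sq_less mem_confocal_quadric_iff[of a x b p] by auto
  qed (use k Q[of k0] sq_less mem_confocal_quadric_iff[of a k0 b p] in auto)
  moreover have "two_sheeted_param a b p = k2"
    unfolding two_sheeted_param_def
  proof (rule the_equality)
    fix x assume "- a\<^sup>2 < x \<and> x < - b\<^sup>2 \<and> p \<in> confocal_quadric a b x"
    then show "x = k2" using k Q[of x] sq_less mem_confocal_quadric_iff[of a x b p] by auto
  qed (use k Q[of k2] sq_less mem_confocal_quadric_iff[of a k2 b p] in auto)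
  ultimately show thesis using that[of k1] k Q by simp
qed

abbreviation "off_planes \<equiv> {(p :: real^3, w :: real). w \<noteq> 0 \<and> p$1 \<noteq> 0 \<and> p$2 \<noteq> 0 \<and> p$3 \<noteq> 0}"

lemma off_planesE:
  assumes "(p, w) \<in> off_planes"
  obtains k0 k1 k2 where "k0 = ellipsoid_param a b (p /\<^sub>R w)" "k2 = two_sheeted_param a b (p /\<^sub>R w)"
    "0 < k0" "- b\<^sup>2 < k1" "k1 < 0" "- a\<^sup>2 < k2" "k2 < - b\<^sup>2"
    "\<And>k. Q (p, w) k = w\<^sup>2 * ((k - k0) * (k - k1) * (k - k2))"
proof -
  have w: "w \<noteq> 0" and "(p /\<^sub>R w)$1 \<noteq> 0" "(p /\<^sub>R w)$2 \<noteq> 0" "(p /\<^sub>R w)$3 \<noteq> 0" using assms by auto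
  from params_eq[OF this(2-4)] obtain k1 where k: "0 < ellipsoid_param a b (p /\<^sub>R w)" "- b\<^sup>2 < k1" "k1 < 0"
    "- a\<^sup>2 < two_sheeted_param a b (p /\<^sub>R w)" "two_sheeted_param a b (p /\<^sub>R w) < - b\<^sup>2"
    "\<And>k. Q (p /\<^sub>R w, 1) k = (k - ellipsoid_param a b (p /\<^sub>R w)) * (k - k1) * (k - two_sheeted_param a b (p /\<^sub>R w))"
    by metis
  have "(p, w) = w *\<^sub>R (p /\<^sub>R w, 1)" using w by simp
  then have "Q (p, w) k = w\<^sup>2 * Q (p /\<^sub>R w, 1) k" for k by (metis confocal_poly_scaleR)
  then show thesis using that k by simp
qed

text \<open>For positive \<open>k\<close> the factors from the two smaller roots are positive, so
  \<open>Q\<close> at \<open>k\<close> has the sign of \<open>k\<close> minus the ellipsoid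
  parameter. Comparison with \<open>k\<close> thus becomes an open condition that still makes sense
  on the coordinate planes and at infinity.\<close>

lemma ellipsoid_param_cmp:
  assumes "(p, w) \<in> off_planes" and k: "0 < k"
  shows "k < ellipsoid_param a b (p /\<^sub>R w) \<longleftrightarrow> Q (p, w) k < 0"
    and "ellipsoid_param a b (p /\<^sub>R w) < k \<longleftrightarrow> 0 < Q (p, w) k"
proof -
  obtain k0 k1 k2 where *: "k0 = ellipsoid_param a b (p /\<^sub>R w)"
    "k1 < 0" "k2 < - b\<^sup>2" "Q (p, w) k = w\<^sup>2 * ((k - k0) * (k - k1) * (k - k2))"
    using off_planesE[OF assms(1)] by metis
  have "0 < k - k1" "0 < k - k2" using * k sq_less(2) by linarith+
  moreover have "w \<noteq> 0" using assms(1) by auto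
  ultimately have "0 < w\<^sup>2 * ((k - k1) * (k - k2))" by simp
  moreover have "Q (p, w) k = (k - k0) * (w\<^sup>2 * ((k - k1) * (k - k2)))" using * by simp
  ultimately show "k < ellipsoid_param a b (p /\<^sub>R w) \<longleftrightarrow> Q (p, w) k < 0"
    "ellipsoid_param a b (p /\<^sub>R w) < k \<longleftrightarrow> 0 < Q (p, w) k"
    unfolding *(1)[symmetric] by (auto simp: mult_less_0_iff zero_less_mult_iff)
qed

text \<open>Between \<open>- a^2\<close> and \<open>- b^2\<close> the factors from the two larger
  roots are both negative, so their product does not affect the sign.\<close>

lemma two_sheeted_param_cmp:
  assumes "(p, w) \<in> off_planes" and k: "- a\<^sup>2 < k" "k < - b\<^sup>2"
  shows "k < two_sheeted_param a b (p /\<^sub>R w) \<longleftrightarrow> Q (p, w) k < 0"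
    and "two_sheeted_param a b (p /\<^sub>R w) < k \<longleftrightarrow> 0 < Q (p, w) k"
proof -
  obtain k0 k1 k2 where *: "0 < k0" "- b\<^sup>2 < k1" "k2 = two_sheeted_param a b (p /\<^sub>R w)"
     "Q (p, w) k = w\<^sup>2 * ((k - k0) * (k - k1) * (k - k2))"
    using off_planesE[OF assms(1)] by metis
  have "k - k0 < 0" "k - k1 < 0" using * k sq_less(2) by linarith+
  moreover have "w \<noteq> 0" using assms(1) by auto
  ultimately have "0 < w\<^sup>2 * ((k - k0) * (k - k1))" by (simp add: mult_neg_neg)
  moreover have "Q (p, w) k = (k - k2) * (w\<^sup>2 * ((k - k0) * (k - k1)))" using * by simp
  ultimately show "k < two_sheeted_param a b (p /\<^sub>R w) \<longleftrightarrow> Q (p, w) k < 0"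
    "two_sheeted_param a b (p /\<^sub>R w) < k \<longleftrightarrow> 0 < Q (p, w) k"
    unfolding *(3)[symmetric] by (auto simp: mult_less_0_iff zero_less_mult_iff)
qed

section \<open>Limits of the elliptic coordinates\<close>

lemma eventually_confocal_poly_sign:
  shows "Q h k < 0 \<Longrightarrow> \<forall>\<^sub>F x in inf (nhds h) (principal S). x \<in> S \<and> Q x k < 0"
    and "0 < Q h k \<Longrightarrow> \<forall>\<^sub>F x in inf (nhds h) (principal S). x \<in> S \<and> 0 < Q x k"
proof -
  have "isCont (\<lambda>x. Q x k) h"
    using continuous_confocal_poly[of a b k] by (metis UNIV_I continuous_on_eq_continuous_at open_UNIV)
  then have t: "((\<lambda>x. Q x k) \<longlongrightarrow> Q h k) (nhds h)"
    using tendsto_at_iff_tendsto_nhds[of "\<lambda>x. Q x k" h] by (simp only: isCont_def)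
  show "\<forall>\<^sub>F x in inf (nhds h) (principal S). x \<in> S \<and> Q x k < 0" if "Q h k < 0"
    using order_tendstoD(2)[OF t that] unfolding eventually_inf_principal by eventually_elim simp
  show "\<forall>\<^sub>F x in inf (nhds h) (principal S). x \<in> S \<and> 0 < Q x k" if "0 < Q h k"
    using order_tendstoD(1)[OF t that] unfolding eventually_inf_principal by eventually_elim simp
qed

text \<open>\<open>Q\<close> is homogeneous of degree 2 in the point, so its sign does not depend on
  the representative.\<close>

lemma confocal_poly_span_cong:
  assumes "h \<in> span {h0} - {0}"
  shows "Q h k < 0 \<longleftrightarrow> Q h0 k < 0" and "0 < Q h k \<longleftrightarrow> 0 < Q h0 k"
proof -
  obtain r where r: "h = r *\<^sub>R h0" using assms by (auto simp: span_singleton)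
  then have "r \<noteq> 0" using assms by auto
  then show "Q h k < 0 \<longleftrightarrow> Q h0 k < 0" "0 < Q h k \<longleftrightarrow> 0 < Q h0 k"
    by (auto simp: r confocal_poly_scaleR mult_less_0_iff zero_less_mult_iff)
qed

text \<open>A real \<open>k\<close> strictly between \<open>l\<close> and a bound \<open>y\<close>
  serves as test value: the sign of \<open>Q\<close> at \<open>h0\<close> carries over to
  \<open>h\<close> and its neighbourhood and bounds the parameter there by
  \<open>ellipsoid_param_cmp\<close>. For \<open>l = \<infinity>\<close> only \<open>neg\<close> has
  content.\<close>

lemma has_k0I:
  fixes l :: ereal
  assumes l: "0 \<le> l"
    and neg: "\<And>k. 0 < k \<Longrightarrow> ereal k < l \<Longrightarrow> Q h0 k < 0"
    and pos: "\<And>k. 0 < k \<Longrightarrow> l < ereal k \<Longrightarrow> 0 < Q h0 k"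
  shows "has_k0 a b (span {h0}) l"
  unfolding has_k0_def limit_value_def
proof (intro ballI order_tendstoI)
  fix h y assume h: "h \<in> span {h0} - {0}" and y: "y < l"
  show "\<forall>\<^sub>F x in inf (nhds h) (principal off_planes). y < (case x of (p, w) \<Rightarrow> ereal (ellipsoid_param a b (p /\<^sub>R w)))"
  \<comment> \<open>The sign test requires a positive \<open>k\<close>; for negative
    \<open>y\<close> the bound holds because ellipsoid parameters are positive.\<close>
  proof (cases "y < 0")
    case True
    have "y < ereal (ellipsoid_param a b (p /\<^sub>R w))" if "(p, w) \<in> off_planes" for p w
    proof -
      from off_planesE[OF that] have "0 < ellipsoid_param a b (p /\<^sub>R w)" by metis
      then show ?thesis using True by (meson ereal_less(2) less_trans)
    qed
    then show ?thesis by (auto simp: eventually_inf_principal intro!: always_eventually)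
  next
    case False
    obtain k where k: "y < ereal k" "ereal k < l" using ereal_dense2[OF y] by auto
    then have k0: "0 < k" using False by (metis ereal_less(2) leI le_less_trans)
    then have "Q h k < 0" using neg k confocal_poly_span_cong[OF h] by auto
    from eventually_confocal_poly_sign(1)[OF this] show ?thesis
    proof eventually_elim
      case (elim x)
      then have "ereal k < ereal (ellipsoid_param a b (fst x /\<^sub>R snd x))"
        using ellipsoid_param_cmp(1)[of "fst x" "snd x" k] k0 by simp
      then show ?case using k(1) unfolding case_prod_beta by (metis less_trans)
    qed
  qed
next
  fix h y assume h: "h \<in> span {h0} - {0}" and y: "l < y"
  obtain k where k: "l < ereal k" "ereal k < y" using ereal_dense2[OF y] by auto
  then have k0: "0 < k" using l by (metis ereal_less(2) le_less_trans)
  then have "0 < Q h k" using pos k confocal_poly_span_cong[OF h] by auto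
  from eventually_confocal_poly_sign(2)[OF this]
  show "\<forall>\<^sub>F x in inf (nhds h) (principal off_planes). (case x of (p, w) \<Rightarrow> ereal (ellipsoid_param a b (p /\<^sub>R w))) < y"
  proof eventually_elim
    case (elim x)
    then have "ereal (ellipsoid_param a b (fst x /\<^sub>R snd x)) < ereal k"
      using ellipsoid_param_cmp(2)[of "fst x" "snd x" k] k0 by simp
    then show ?case using k(2) unfolding case_prod_beta by (metis less_trans)
  qed
qed

text \<open>The same sign test, carried out with real limits and with \<open>y\<close> itself as
  test value. If \<open>y\<close> lies outside the range of the parameter, that range already gives
  the bound; so \<open>l\<close> may be an end of the range.\<close>

lemma has_k2I:
  assumes l: "- a\<^sup>2 \<le> l" "l \<le> - b\<^sup>2"
    and neg: "\<And>k. - a\<^sup>2 < k \<Longrightarrow> k < l \<Longrightarrow> Q h0 k < 0"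
    and pos: "\<And>k. l < k \<Longrightarrow> k < - b\<^sup>2 \<Longrightarrow> 0 < Q h0 k"
  shows "has_k2 a b (span {h0}) (ereal l)"
  unfolding has_k2_def limit_value_def
proof
  fix h assume h: "h \<in> span {h0} - {0}"
  let ?F = "inf (nhds h) (principal off_planes)"
  let ?f = "\<lambda>(p, w). two_sheeted_param a b (p /\<^sub>R w)"
  have "(?f \<longlongrightarrow> l) ?F"
  proof (rule order_tendstoI)
    fix y assume y: "y < l"
    show "\<forall>\<^sub>F x in ?F. y < ?f x"
    proof (cases "y \<le> - a\<^sup>2")
      case True
      have "y < two_sheeted_param a b (p /\<^sub>R w)" if "(p, w) \<in> off_planes" for p w
        by (rule off_planesE[OF that]) (use True in auto)
      then show ?thesis by (auto simp: eventually_inf_principal intro!: always_eventually)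
    next
      case False
      then have "Q h y < 0" using neg y confocal_poly_span_cong[OF h] by auto
      from eventually_confocal_poly_sign(1)[OF this] show ?thesis
      proof eventually_elim
        case (elim x)
        then show ?case using two_sheeted_param_cmp(1)[of "fst x" "snd x" y] y False l
          by (auto simp: case_prod_beta)
      qed
    qed
  next
    fix y assume y: "l < y"
    show "\<forall>\<^sub>F x in ?F. ?f x < y"
    proof (cases "- b\<^sup>2 \<le> y")
      case True
      have "two_sheeted_param a b (p /\<^sub>R w) < y" if "(p, w) \<in> off_planes" for p w
        by (rule off_planesE[OF that]) (use True in auto)
      then show ?thesis by (auto simp: eventually_inf_principal intro!: always_eventually)
    next
      case False
      then have "0 < Q h y" using pos y confocal_poly_span_cong[OF h] by auto
      from eventually_confocal_poly_sign(2)[OF this] show ?thesis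
      proof eventually_elim
        case (elim x)
        then show ?case using two_sheeted_param_cmp(2)[of "fst x" "snd x" y] y False l
          by (auto simp: case_prod_beta)
      qed
    qed
  qed
  then show "((\<lambda>(p, w). ereal (two_sheeted_param a b (p /\<^sub>R w))) \<longlongrightarrow> ereal l) ?F"
    unfolding case_prod_beta by (rule tendsto_ereal)
qed

text \<open>Density of \<open>off_planes\<close>, which makes limits unique. Along
  \<open>h + e *\<^sub>R (1, 1)\<close> each homogeneous coordinate vanishes for a single
  \<open>e\<close>, so all sufficiently small nonzero \<open>e\<close> give points of
  \<open>off_planes\<close>.\<close>

lemma inf_nhds_off_planes_neq_bot: "inf (nhds h) (principal off_planes) \<noteq> bot"
proof -
  obtain p w where h: "h = (p, w)" by (cases h)
  let ?g = "\<lambda>e::real. h + e *\<^sub>R (1 :: real^3, 1 :: real)"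
  have "(?g \<longlongrightarrow> h + 0 *\<^sub>R (1, 1)) (at 0)" by (intro tendsto_intros)
  then have 1: "filterlim ?g (nhds h) (at 0)" by (simp only: scaleR_zero_left add_0_right)
  have "\<forall>\<^sub>F e in at 0. e \<noteq> - x" for x :: real
    by (rule eventually_neq_at_within)
  then have "\<forall>\<^sub>F e in at 0. e \<noteq> - w \<and> e \<noteq> - p$1 \<and> e \<noteq> - p$2 \<and> e \<noteq> - p$3"
    by (intro eventually_conj)
  then have "\<forall>\<^sub>F e in at 0. ?g e \<in> off_planes"
    by eventually_elim (auto simp: h)
  with 1 have 2: "filterlim ?g (inf (nhds h) (principal off_planes)) (at 0)"
    by (simp add: filterlim_inf filterlim_principal)
  show ?thesis
  proof
    assume "inf (nhds h) (principal off_planes) = bot"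
    with 2 have "filterlim ?g bot (at 0)" by (simp only:)
    then have "\<forall>\<^sub>F e in at (0::real). False" unfolding filterlim_iff
      by (auto dest: spec[of _ "\<lambda>_. False"])
    then show False by (simp add: eventually_False)
  qed
qed

lemma limit_value_unique:
  assumes "h0 \<noteq> 0" "limit_value f (span {h0}) k" "limit_value f (span {h0}) k'"
  shows "k = k'"
proof -
  have "h0 \<in> span {h0} - {0}" using assms by (simp add: span_base)
  then show ?thesis using assms(2,3) tendsto_unique[OF inf_nhds_off_planes_neq_bot]
    unfolding limit_value_def by blast
qed

end

section \<open>The one-sheeted hyperboloid\<close>

text \<open>\<open>A\<close> and \<open>B\<close> are the constants of the confocal family,
  \<open>a\<close>, \<open>b\<close>, \<open>c\<close> the semi-axes of its member with parameter
  \<open>- c^2\<close>, and \<open>s\<close> is the sign in the third coordinate of the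
  mapping.\<close>

locale confocal_hyperboloid =
  fixes A B a b c m s :: real
  assumes B_pos: "0 < B" and B_less_A: "B < A"
    and semi_axes_pos: "0 < a" "0 < b" "0 < c"
    and a_sq: "a\<^sup>2 = A\<^sup>2 - c\<^sup>2" and b_sq: "b\<^sup>2 = B\<^sup>2 - c\<^sup>2"
    and m_sq: "m\<^sup>2 * A\<^sup>2 = A\<^sup>2 - B\<^sup>2"
    and s_sq: "s\<^sup>2 = 1"
begin

sublocale confocal_family A B
  using B_pos B_less_A by unfold_locales

sublocale elliptic_modulus m
proof
  have "m\<^sup>2 * A\<^sup>2 < 1 * A\<^sup>2" using m_sq sq_less by simp
  then show "m\<^sup>2 < 1" using sq_less(3) by (simp only: mult_less_cancel_right)
qed

lemma c_sq_less: "c\<^sup>2 < B\<^sup>2"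
  using b_sq semi_axes_pos by (smt (verit) zero_less_power)

text \<open>Homogeneous coordinates of \<open>Z(u, v)\<close>, which make no distinction between finite and ideal
  points.\<close>

definition hom :: "real \<Rightarrow> real \<Rightarrow> (real^3) \<times> real" where
  "hom u v = (vector [- a * (sn u * dn v), b * cn u, s * c * (dn u * sn v)], cn v)"

lemma hom_nth [simp]:
  "fst (hom u v) $ 1 = - a * (sn u * dn v)" "fst (hom u v) $ 2 = b * cn u"
  "fst (hom u v) $ 3 = s * c * (dn u * sn v)" "snd (hom u v) = cn v"
  by (simp_all add: hom_def)

lemma hom_Z_affine: "cn v \<noteq> 0 \<Longrightarrow> hom u v = cn v *\<^sub>R (Z_affine a b c m s u v, 1)"
  by (simp add: hom_def Z_affine_def vec_eq_iff forall_3)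

lemma Z_map_eq: "Z_map a b c m s (u, v) = span {hom u v}"
proof (cases "cn v = 0")
  case True
  then show ?thesis by (simp add: Z_map_def ideal_point_def Z_ideal_direction_def hom_def)
next
  case False
  then show ?thesis
    by (simp add: Z_map_def finite_point_def hom_Z_affine span_singleton_scaleR del: scaleR_Pair)
qed

lemma s_neq_0: "s \<noteq> 0"
  using s_sq by auto

lemma hom_nonzero: "hom u v \<noteq> 0"
proof
  assume "hom u v = 0"
  then have "cn v = 0" "s * c * (dn u * sn v) = 0" using hom_nth(3,4)[of u v] by simp_all
  then show False using dn_pos[of u] semi_axes_pos s_neq_0 sn_cn_sq[of v] by simp
qed

text \<open>The root \<open>- c^2\<close> is the parameter of the hyperboloid that carries the
  point. The other two factors separate the variables \<open>u\<close> and \<open>v\<close>.\<close>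

lemma confocal_poly_hom:
  "Q (hom u v) k = (k + c\<^sup>2) * (k + A\<^sup>2 * (dn u)\<^sup>2) * ((cn v)\<^sup>2 * k - B\<^sup>2 * (sn v)\<^sup>2)"
proof -
  have "Q (hom u v) k = (cn v)\<^sup>2 * (A\<^sup>2 + k) * (B\<^sup>2 + k) * k - a\<^sup>2 * (sn u)\<^sup>2 * (dn v)\<^sup>2 * (B\<^sup>2 + k) * k
      - b\<^sup>2 * (cn u)\<^sup>2 * (A\<^sup>2 + k) * k - s\<^sup>2 * c\<^sup>2 * (dn u)\<^sup>2 * (sn v)\<^sup>2 * (A\<^sup>2 + k) * (B\<^sup>2 + k)"
    by (simp add: confocal_poly_def power_mult_distrib)
  also have "\<dots> = (k + c\<^sup>2) * (k + A\<^sup>2 * (dn u)\<^sup>2) * ((cn v)\<^sup>2 * k - B\<^sup>2 * (sn v)\<^sup>2)"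
    unfolding dn_sq sn_cn_sq a_sq b_sq s_sq using m_sq by algebra
  finally show ?thesis .
qed

lemma k0_factor_neg: "k < 0 \<Longrightarrow> (cn v)\<^sup>2 * k - B\<^sup>2 * (sn v)\<^sup>2 < 0"
proof -
  assume k: "k < 0"
  show ?thesis
  proof (cases "cn v = 0")
    case True
    then have "(sn v)\<^sup>2 = 1" using sn_cn_sq[of v] by simp
    then show ?thesis using True sq_less(2) by simp
  next
    case False
    then have "(cn v)\<^sup>2 * k < 0" using k by (simp add: mult_pos_neg)
    moreover have "0 \<le> B\<^sup>2 * (sn v)\<^sup>2" by simp
    ultimately show ?thesis by linarith
  qed
qed

lemma k2_eq: "A\<^sup>2 * (dn u)\<^sup>2 = A\<^sup>2 - (A\<^sup>2 - B\<^sup>2) * (sn u)\<^sup>2"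
  unfolding dn_sq m_sq[symmetric] by (simp add: algebra_simps)

lemma k2_bounds: "B\<^sup>2 \<le> A\<^sup>2 * (dn u)\<^sup>2" "A\<^sup>2 * (dn u)\<^sup>2 \<le> A\<^sup>2"
proof -
  have "(A\<^sup>2 - B\<^sup>2) * (sn u)\<^sup>2 \<le> A\<^sup>2 - B\<^sup>2" "0 \<le> (A\<^sup>2 - B\<^sup>2) * (sn u)\<^sup>2"
    using sq_less sn_sq_le_1[of u] by (simp_all add: mult_left_le)
  then show "B\<^sup>2 \<le> A\<^sup>2 * (dn u)\<^sup>2" "A\<^sup>2 * (dn u)\<^sup>2 \<le> A\<^sup>2" unfolding k2_eq by linarith+
qed

lemma has_k2_hom: "has_k2 A B (span {hom u v}) (ereal (- (A\<^sup>2 * (dn u)\<^sup>2)))"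
proof (rule has_k2I)
  fix k assume "- A\<^sup>2 < k" "k < - (A\<^sup>2 * (dn u)\<^sup>2)"
  then have "k + c\<^sup>2 < 0" "k + A\<^sup>2 * (dn u)\<^sup>2 < 0" "k < 0" using k2_bounds[of u] c_sq_less sq_less(2) by linarith+
  then show "Q (hom u v) k < 0"
    unfolding confocal_poly_hom using k0_factor_neg by (simp add: mult_neg_neg mult_pos_neg)
next
  fix k assume "- (A\<^sup>2 * (dn u)\<^sup>2) < k" "k < - B\<^sup>2"
  then have "k + c\<^sup>2 < 0" "0 < k + A\<^sup>2 * (dn u)\<^sup>2" "k < 0" using c_sq_less sq_less(2) by linarith+
  then show "0 < Q (hom u v) k"
    unfolding confocal_poly_hom using k0_factor_neg by (simp add: mult_neg_pos mult_neg_neg)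
qed (use k2_bounds[of u] in simp_all)

text \<open>At ideal points the last factor of the cubic is the negative constant
  \<open>- B^2\<close>: its root has moved to infinity.\<close>

lemma has_k0_hom: "has_k0 A B (span {hom u v}) (if cn v = 0 then \<infinity> else ereal (B\<^sup>2 * (sn v)\<^sup>2 / (cn v)\<^sup>2))"
proof -
  have pos: "0 < (k + c\<^sup>2) * (k + A\<^sup>2 * (dn u)\<^sup>2)" if "0 < k" for k
    using that by (intro mult_pos_pos add_pos_nonneg) auto
  show ?thesis
  proof (rule has_k0I)
    fix k assume k: "0 < k" "ereal k < (if cn v = 0 then \<infinity> else ereal (B\<^sup>2 * (sn v)\<^sup>2 / (cn v)\<^sup>2))"
    have "(cn v)\<^sup>2 * k - B\<^sup>2 * (sn v)\<^sup>2 < 0"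
    proof (cases "cn v = 0")
      case True
      then have "(sn v)\<^sup>2 = 1" using sn_cn_sq[of v] by simp
      then show ?thesis using True sq_less(2) by simp
    qed (use k in \<open>simp add: field_simps\<close>)
    with pos[OF k(1)] show "Q (hom u v) k < 0"
      unfolding confocal_poly_hom by (rule mult_pos_neg)
  next
    fix k assume k: "0 < k" "(if cn v = 0 then \<infinity> else ereal (B\<^sup>2 * (sn v)\<^sup>2 / (cn v)\<^sup>2)) < ereal k"
    then have "0 < (cn v)\<^sup>2 * k - B\<^sup>2 * (sn v)\<^sup>2"
      by (auto split: if_splits simp: field_simps)
    with pos[OF k(1)] show "0 < Q (hom u v) k"
      unfolding confocal_poly_hom by (rule mult_pos_pos)
  qed simp
qed

section \<open>Injectivity\<close>

lemma k2_eqD: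
  assumes "A\<^sup>2 * (dn u)\<^sup>2 = A\<^sup>2 * (dn v)\<^sup>2"
  shows "dn u = dn v" "(sn u)\<^sup>2 = (sn v)\<^sup>2"
proof -
  have "(dn u)\<^sup>2 = (dn v)\<^sup>2" using assms sq_less(3) by simp
  then show "dn u = dn v" using dn_pos[of u] dn_pos[of v] by (simp add: power2_eq_iff_nonneg)
  have "(A\<^sup>2 - B\<^sup>2) * (sn u)\<^sup>2 = (A\<^sup>2 - B\<^sup>2) * (sn v)\<^sup>2" using assms unfolding k2_eq by simp
  then show "(sn u)\<^sup>2 = (sn v)\<^sup>2" using sq_less(1) by simp
qed

text \<open>The value of \<open>k2\<close> is determined by the projective point, so
  \<open>dn u = dn u'\<close>. Proportionality of the homogeneous coordinates then makes
  \<open>(sn v, cn v)\<close> the \<open>r\<close>-fold of \<open>(sn v', cn v')\<close>; both lie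
  on the unit circle, so \<open>r^2 = 1\<close>. The case \<open>r = - 1\<close> is excluded by
  \<open>cn\<close> being nonnegative, and at ideal points by \<open>v = v' = - K\<close>.\<close>

lemma inj_on_Z_map: "inj_on (Z_map a b c m s) ({- K..<3 * K} \<times> {- K..<K})"
proof -
  have "u = u' \<and> v = v'"
    if u: "u \<in> {- K..<3 * K}" "u' \<in> {- K..<3 * K}" and v: "v \<in> {- K..<K}" "v' \<in> {- K..<K}"
      and eq: "span {hom u v} = span {hom u' v'}" for u v u' v'
  proof -
    obtain r where r: "r \<noteq> 0" "hom u v = r *\<^sub>R hom u' v'"
      using span_singleton_eqE[OF eq hom_nonzero] .
    have "has_k2 A B (span {hom u v}) (ereal (- (A\<^sup>2 * (dn u')\<^sup>2)))"
      unfolding eq by (rule has_k2_hom)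
    then have "A\<^sup>2 * (dn u)\<^sup>2 = A\<^sup>2 * (dn u')\<^sup>2"
      using limit_value_unique[OF hom_nonzero] has_k2_hom[of u v] unfolding has_k2_def by fastforce
    note du = k2_eqD[OF this]
    have e1: "sn u * dn v = r * (sn u' * dn v')" and e2: "cn u = r * cn u'"
      and e3: "dn u * sn v = r * (dn u' * sn v')" and e4: "cn v = r * cn v'"
      using r(2) hom_nth[of u v] semi_axes_pos s_neq_0 by simp_all
    have e3: "sn v = r * sn v'" using e3 du(1) dn_pos[of u'] by simp
    have "(sn v)\<^sup>2 + (cn v)\<^sup>2 = r\<^sup>2 * ((sn v')\<^sup>2 + (cn v')\<^sup>2)"
      unfolding e3 e4 by (simp add: power_mult_distrib distrib_left)
    then have r2: "r\<^sup>2 = 1" by (simp add: sn_cn_sq)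
    have "r = 1"
    proof (cases "cn v = 0")
      case True
      then have "cn v' = 0" using e4 r by simp
      then have "v = - K" "v' = - K" using True cn_eq_0_iff v by auto
      then show ?thesis using e3 by simp
    next
      case False
      then have "0 < r * cn v'" using cn_nonneg[OF v(1)] unfolding e4[symmetric] by linarith
      moreover have "0 \<le> cn v'" by (rule cn_nonneg[OF v(2)])
      ultimately have "0 < r" by (simp add: zero_less_mult_iff)
      then show ?thesis using r2 by (simp add: power2_eq_1_iff)
    qed
    have dv: "dn v = dn v'" using e3 \<open>r = 1\<close> by (simp add: jacobi_dn_def)
    have "v = v'"
      using reduced_argument_unique[of v v'] v K_pos e3 e4 \<open>r = 1\<close> by simp
    moreover have "u = u'"
      using reduced_argument_unique[OF u] e1 e2 dv dn_pos[of v'] \<open>r = 1\<close> by simp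
    ultimately show ?thesis by simp
  qed
  then show ?thesis by (auto simp: inj_on_def Z_map_eq)
qed

section \<open>Surjectivity\<close>

lemma hom_on_cone:
  "(fst (hom u v) $ 1)\<^sup>2 / a\<^sup>2 + (fst (hom u v) $ 2)\<^sup>2 / b\<^sup>2 - (fst (hom u v) $ 3)\<^sup>2 / c\<^sup>2 = (snd (hom u v))\<^sup>2"
proof -
  have "(sn u)\<^sup>2 * (dn v)\<^sup>2 + (cn u)\<^sup>2 - s\<^sup>2 * ((dn u)\<^sup>2 * (sn v)\<^sup>2) = (cn v)\<^sup>2"
    unfolding dn_sq sn_cn_sq s_sq by algebra
  then show ?thesis
    using semi_axes_pos by (simp add: power_mult_distrib)
qed

text \<open>After scaling, the system to solve is \<open>x = - r * sn u * dn v\<close>,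
  \<open>y = r * cn u\<close>, \<open>z = r * dn u * sn v\<close>, \<open>w = r * cn v\<close>. The
  intermediate value theorem yields the square of \<open>sn v\<close>; then come \<open>r\<close>,
  \<open>u\<close> from the first two equations and \<open>v\<close> from the last two.\<close>

lemma ex_hom_of_cone:
  assumes nz: "(p, w) \<noteq> 0" and cone: "(p$1)\<^sup>2 / a\<^sup>2 + (p$2)\<^sup>2 / b\<^sup>2 - (p$3)\<^sup>2 / c\<^sup>2 = w\<^sup>2"
  obtains u v r where "u \<in> {- K..<3 * K}" "v \<in> {- K..<K}" "r \<noteq> 0" "(p, w) = r *\<^sub>R hom u v"
proof -
  define x y z where "x = p$1 / a" and "y = p$2 / b" and "z = p$3 / (s * c)"
  have p: "p$1 = a * x" "p$2 = b * y" "p$3 = s * c * z"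
    using semi_axes_pos s_neq_0 by (simp_all add: x_def y_def z_def)
  have cone: "x\<^sup>2 + y\<^sup>2 = z\<^sup>2 + w\<^sup>2"
    using cone semi_axes_pos by (simp add: p power_mult_distrib s_sq)
  have nz: "z\<^sup>2 + w\<^sup>2 \<noteq> 0"
  proof
    assume *: "z\<^sup>2 + w\<^sup>2 = 0"
    then have "x\<^sup>2 + y\<^sup>2 = 0" using cone by simp
    then have "p = 0" "w = 0" using * by (simp_all add: vec_eq_iff forall_3 p)
    then show False using nz by (simp add: zero_prod_def)
  qed
  have g: "0 < 1 - m\<^sup>2 * t" if "t \<le> 1" "0 \<le> t" for t
    using radicand_pos[of "sqrt t"] that by simp
  \<comment> \<open>\<open>t\<close> will be \<open>sn\<^sup>2 v\<close>, and \<open>l\<close> the square of the factor \<open>r\<close>; \<open>f t = 0\<close> arises by eliminating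
    \<open>u\<close> and \<open>r\<close>.\<close>
  define f where "f t = (1 - t) * (x\<^sup>2 + y\<^sup>2 * (1 - m\<^sup>2 * t)) - w\<^sup>2 * (1 - m\<^sup>2 * t)" for t
  have "f 0 = z\<^sup>2" using cone by (simp add: f_def)
  moreover have "f 1 \<le> 0" using g[of 1] by (simp add: f_def)
  moreover have "isCont f t" for t unfolding f_def by (intro continuous_intros)
  ultimately obtain t where t: "0 \<le> t" "t \<le> 1" "f t = 0"
    using IVT2[of f 1 0 0] by auto
  define d where "d = sqrt (1 - m\<^sup>2 * t)"
  have d: "0 < d" "d\<^sup>2 = 1 - m\<^sup>2 * t" using g[OF t(2,1)] by (simp_all add: d_def)
  define l where "l = x\<^sup>2 / d\<^sup>2 + y\<^sup>2"
  have l0: "0 \<le> l" by (simp add: l_def)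
  have "d\<^sup>2 * l = x\<^sup>2 + y\<^sup>2 * d\<^sup>2" using d(1) by (simp add: l_def field_simps)
  then have "d\<^sup>2 * (l * (1 - t)) = d\<^sup>2 * w\<^sup>2" using t(3) unfolding f_def d(2)[symmetric] by algebra
  then have l_w: "l * (1 - t) = w\<^sup>2" using d(1) by simp
  have "x\<^sup>2 + y\<^sup>2 \<noteq> 0" using nz cone by simp
  then have "l \<noteq> 0" using d(1) l0 unfolding l_def by (auto simp: add_nonneg_eq_0_iff)
  then have l: "0 < l" using l0 by simp
  \<comment> \<open>The squared equations leave the sign of \<open>r\<close> open. It is chosen so
    that \<open>cn v = w / r\<close> is nonnegative and, if \<open>w = 0\<close>,
    \<open>sn v\<close> is nonpositive; this puts \<open>v\<close> into the half-open
    interval.\<close>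
  define r where "r = (if w = 0 \<and> 0 < z \<or> w < 0 then - sqrt l else sqrt l)"
  have r: "r \<noteq> 0" "r\<^sup>2 = l" using l by (simp_all add: r_def)
  have r_w: "0 \<le> w / r" and r_z: "w = 0 \<Longrightarrow> z / r \<le> 0"
    using l by (auto simp: r_def divide_simps)
  have "(y / r)\<^sup>2 + (- x / (r * d))\<^sup>2 = (y\<^sup>2 + x\<^sup>2 / d\<^sup>2) / r\<^sup>2"
    by (simp add: power_divide power_mult_distrib add_divide_distrib)
  also have "\<dots> = 1" unfolding r(2) l_def[symmetric] using l by (simp add: l_def add.commute)
  finally obtain u where u: "u \<in> {- K..<3 * K}" "cn u = y / r" "sn u = - x / (r * d)"
    by (rule ex_sn_cn)
  have r2: "0 < r\<^sup>2" using r(1) by simp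
  have su: "(sn u)\<^sup>2 * (l * d\<^sup>2) = x\<^sup>2" and cu: "(cn u)\<^sup>2 * l = y\<^sup>2"
  proof -
    have "sn u * (r * d) = - x" "cn u * r = y" using u r d by simp_all
    then show "(sn u)\<^sup>2 * (l * d\<^sup>2) = x\<^sup>2" "(cn u)\<^sup>2 * l = y\<^sup>2"
      unfolding r(2)[symmetric] power_mult_distrib[symmetric] by simp_all
  qed
  \<comment> \<open>The choice of \<open>t\<close> involved \<open>x\<close>, \<open>y\<close> and
    \<open>w\<close>; the cone equation now makes it consistent with \<open>z\<close>, so that the
    coordinates intended for \<open>(cn v, sn v)\<close> lie on the unit circle.\<close>
  have "(dn u)\<^sup>2 * t * l = z\<^sup>2"
  proof -
    have "(dn u)\<^sup>2 * t * l = t * l - (1 - d\<^sup>2) * (sn u)\<^sup>2 * l"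
      unfolding dn_sq d(2) by (simp add: algebra_simps)
    also have "\<dots> = (l - w\<^sup>2) - (sn u)\<^sup>2 * l + x\<^sup>2" using l_w su by algebra
    also have "\<dots> = z\<^sup>2" using cu sn_cn_sq[of u] cone by algebra
    finally show ?thesis .
  qed
  then have "(w / r)\<^sup>2 + (z / (r * dn u))\<^sup>2 = 1"
    using r l_w dn_pos[of u] l
    by (simp add: power_divide power_mult_distrib divide_simps) algebra
  then obtain v where v: "v \<in> {- K..<3 * K}" "cn v = w / r" "sn v = z / (r * dn u)"
    by (rule ex_sn_cn)
  have "sn v = - 1" if "cn v = 0"
  proof -
    have "w = 0" using that v r by simp
    then have "sn v \<le> 0" using r_z dn_pos[of u] v(3) by (metis divide_divide_eq_left divide_nonpos_pos)
    moreover have "(sn v)\<^sup>2 = 1" using that sn_cn_sq[of v] by simp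
    ultimately show ?thesis by (auto simp: power2_eq_1_iff)
  qed
  moreover have "0 \<le> cn v" using r_w v(2) by simp
  ultimately have v_V: "v \<in> {- K..<K}" using cn_nonneg_reduced[OF v(1)] by blast
  \<comment> \<open>So far \<open>d\<close> was only a candidate for \<open>dn v\<close>, used in
    the choice of \<open>u\<close>; this identifies the two.\<close>
  have "(sn v)\<^sup>2 = t"
  proof -
    have "l * (cn v)\<^sup>2 = w\<^sup>2"
      unfolding v(2) r(2)[symmetric] using r(1) by (simp add: power_divide)
    then have "l * (cn v)\<^sup>2 = l * (1 - t)" using l_w by simp
    then show ?thesis using l sn_cn_sq[of v] by simp
  qed
  then have "dn v = d" by (simp add: jacobi_dn_def d_def)
  then have "(p, w) = r *\<^sub>R hom u v"
    using r d dn_pos[of u] by (simp add: prod_eq_iff vec_eq_iff forall_3 p u v)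
  with that u v_V r show thesis by blast
qed

lemma Z_map_image: "Z_map a b c m s ` ({- K..<3 * K} \<times> {- K..<K}) = hyperboloid_closure a b c"
proof (intro equalityI subsetI)
  fix P assume "P \<in> Z_map a b c m s ` ({- K..<3 * K} \<times> {- K..<K})"
  then obtain u v where "P = span {hom u v}" by (auto simp: Z_map_eq)
  then show "P \<in> hyperboloid_closure a b c"
    using hom_nonzero[of u v] hom_on_cone[of u v] unfolding hyperboloid_closure_def
    by (cases "hom u v") force
next
  fix P assume "P \<in> hyperboloid_closure a b c"
  then obtain p w where P: "P = span {(p, w)}" "(p, w) \<noteq> 0"
    "(p$1)\<^sup>2 / a\<^sup>2 + (p$2)\<^sup>2 / b\<^sup>2 - (p$3)\<^sup>2 / c\<^sup>2 = w\<^sup>2"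
    by (auto simp: hyperboloid_closure_def)
  obtain u v r where *: "u \<in> {- K..<3 * K}" "v \<in> {- K..<K}" "r \<noteq> 0" "(p, w) = r *\<^sub>R hom u v"
    using ex_hom_of_cone[OF P(2,3)] .
  then have "P = Z_map a b c m s (u, v)" by (simp add: P(1) Z_map_eq span_singleton_scaleR)
  then show "P \<in> Z_map a b c m s ` ({- K..<3 * K} \<times> {- K..<K})" using * by blast
qed

lemma Z_affine_in_hyperboloid: "cn v \<noteq> 0 \<Longrightarrow> Z_affine a b c m s u v \<in> hyperboloid a b c"
proof -
  assume v: "cn v \<noteq> 0"
  have "(cn v)\<^sup>2 * ((Z_affine a b c m s u v $ 1)\<^sup>2 / a\<^sup>2 + (Z_affine a b c m s u v $ 2)\<^sup>2 / b\<^sup>2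
     - (Z_affine a b c m s u v $ 3)\<^sup>2 / c\<^sup>2) = (cn v)\<^sup>2 * 1"
    using hom_on_cone[of u v] unfolding hom_Z_affine[OF v]
    by (simp add: power_mult_distrib distrib_left right_diff_distrib)
  then show ?thesis using v unfolding hyperboloid_def mult_cancel_left by simp
qed

lemma hyperboloid_eq_Z_affine:
  assumes "p \<in> hyperboloid a b c"
  obtains u v where "u \<in> {- K..<3 * K}" "v \<in> {- K<..<K}" "p = Z_affine a b c m s u v"
proof -
  obtain u v r where *: "u \<in> {- K..<3 * K}" "v \<in> {- K..<K}" "r \<noteq> 0" "(p, 1) = r *\<^sub>R hom u v"
    using ex_hom_of_cone[of p 1] assms by (auto simp: hyperboloid_def zero_prod_def)
  have r: "r * cn v = 1" using arg_cong[OF *(4), of snd] by simp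
  then have v: "cn v \<noteq> 0" by auto
  then have "v \<noteq> - K" by auto
  moreover have "p = Z_affine a b c m s u v"
    using *(4) r unfolding hom_Z_affine[OF v] by simp
  ultimately show thesis using that[of u v] * by auto
qed

lemma Z_map_finite: "cn v \<noteq> 0 \<Longrightarrow> Z_map a b c m s (u, v) = finite_point (Z_affine a b c m s u v)"
  by (simp add: Z_map_def)

lemma Z_map_finite_image:
  "Z_map a b c m s ` ({- K..<3 * K} \<times> {- K<..<K}) = finite_point ` hyperboloid a b c"
proof (intro equalityI subsetI)
  fix P assume "P \<in> Z_map a b c m s ` ({- K..<3 * K} \<times> {- K<..<K})"
  then obtain u v where "P = Z_map a b c m s (u, v)" "cn v \<noteq> 0"
    using cn_pos by fastforce
  then show "P \<in> finite_point ` hyperboloid a b c"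
    using Z_map_finite Z_affine_in_hyperboloid by blast
next
  fix P assume "P \<in> finite_point ` hyperboloid a b c"
  then obtain p where p: "P = finite_point p" "p \<in> hyperboloid a b c" by blast
  obtain u v where uv: "u \<in> {- K..<3 * K}" "v \<in> {- K<..<K}" "p = Z_affine a b c m s u v"
    using hyperboloid_eq_Z_affine[OF p(2)] .
  then have "P = Z_map a b c m s (u, v)" using p Z_map_finite[of v u] cn_pos[of v] by simp
  then show "P \<in> Z_map a b c m s ` ({- K..<3 * K} \<times> {- K<..<K})" using uv by blast
qed

section \<open>Generators\<close>

definition line_base :: "real \<Rightarrow> real^3" where
  "line_base q = vector [- a * sn q, b * cn q, 0]"

text \<open>The point \<open>line_base q\<close> is the image of \<open>(q, 0)\<close> on the
  ellipse \<open>z = 0\<close>; \<open>e = 1\<close> and \<open>e = - 1\<close> select the two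
  generators through it.\<close>

definition line_dir :: "real \<Rightarrow> real \<Rightarrow> real^3" where
  "line_dir e q = vector [a * cn q, b * sn q, e * s * c]"

definition line_point :: "real \<Rightarrow> real \<Rightarrow> real \<Rightarrow> real \<Rightarrow> (real^3) \<times> real" where
  "line_point e q \<alpha> \<beta> = \<alpha> *\<^sub>R (line_base q, 1) + \<beta> *\<^sub>R (line_dir e q, 0)"

lemma line_point_nth [simp]:
  "fst (line_point e q \<alpha> \<beta>) $ 1 = a * (\<beta> * cn q - \<alpha> * sn q)"
  "fst (line_point e q \<alpha> \<beta>) $ 2 = b * (\<alpha> * cn q + \<beta> * sn q)"
  "fst (line_point e q \<alpha> \<beta>) $ 3 = \<beta> * (e * s * c)"
  "snd (line_point e q \<alpha> \<beta>) = \<alpha>"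
  by (simp_all add: line_point_def line_base_def line_dir_def algebra_simps)

text \<open>Divided by \<open>a\<close> and \<open>b\<close>, the first two coordinates are the
  vector \<open>(\<beta>, \<alpha>)\<close> rotated by the angle \<open>am q\<close>, so their
  squares add up to those of \<alpha> and \<beta>.\<close>

lemma line_point_on_cone:
  assumes "e\<^sup>2 = 1"
  shows "(fst (line_point e q \<alpha> \<beta>) $ 1)\<^sup>2 / a\<^sup>2 + (fst (line_point e q \<alpha> \<beta>) $ 2)\<^sup>2 / b\<^sup>2
    - (fst (line_point e q \<alpha> \<beta>) $ 3)\<^sup>2 / c\<^sup>2 = (snd (line_point e q \<alpha> \<beta>))\<^sup>2"
proof -
  have "(\<beta> * cn q - \<alpha> * sn q)\<^sup>2 + (\<alpha> * cn q + \<beta> * sn q)\<^sup>2 - \<beta>\<^sup>2 = \<alpha>\<^sup>2"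
    using sn_cn_sq[of q] by algebra
  then show ?thesis
    using semi_axes_pos by (simp add: power_mult_distrib assms s_sq)
qed

text \<open>The case \<open>e = - 1\<close> is \<open>addition_linear\<close> at
  \<open>- v\<close>.\<close>

lemma hom_eq_line_point:
  assumes "e = 1 \<or> e = - 1"
  shows "hom u v = line_point e (u + e * v) (cn v) (e * (dn u * sn v))"
proof -
  have "sn u * dn v = cn v * sn (u + e * v) - e * (dn u * sn v) * cn (u + e * v)"
    and "cn u = cn v * cn (u + e * v) + e * (dn u * sn v) * sn (u + e * v)"
    using assms addition_linear[of u v] addition_linear[of u "- v"] by auto
  moreover have "e\<^sup>2 = 1" using assms by auto
  ultimately have "fst (hom u v) $ 1 = fst (line_point e (u + e * v) (cn v) (e * (dn u * sn v))) $ 1"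
    "fst (hom u v) $ 2 = fst (line_point e (u + e * v) (cn v) (e * (dn u * sn v))) $ 2"
    "fst (hom u v) $ 3 = fst (line_point e (u + e * v) (cn v) (e * (dn u * sn v))) $ 3"
    unfolding hom_nth line_point_nth by algebra+
  then show ?thesis by (simp add: prod_eq_iff vec_eq_iff forall_3)
qed

text \<open>The point lies on the line with parameter \<open>u + e * v\<close> by
  \<open>hom_eq_line_point\<close>. Its last two homogeneous coordinates determine \<alpha> and
  \<beta>, and a nonzero vector together with its rotated image determines the angle up to full
  turns, hence \<open>q\<close> modulo \<open>4 * K\<close>.\<close>

lemma on_line_iff:
  assumes e: "e = 1 \<or> e = - 1"
  shows "(\<exists>\<alpha> \<beta>. hom u v = line_point e q \<alpha> \<beta>) \<longleftrightarrow> (\<exists>n::int. u + e * v = q + 4 * K * of_int n)"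
proof
  assume "\<exists>n::int. u + e * v = q + 4 * K * of_int n"
  then have "sn (u + e * v) = sn q" "cn (u + e * v) = cn q" using sn_cn_eq_iff by blast+
  then have "line_point e (u + e * v) = line_point e q"
    by (simp add: fun_eq_iff line_point_def line_base_def line_dir_def)
  then show "\<exists>\<alpha> \<beta>. hom u v = line_point e q \<alpha> \<beta>" using hom_eq_line_point[OF e, of u v] by metis
next
  assume "\<exists>\<alpha> \<beta>. hom u v = line_point e q \<alpha> \<beta>"
  then obtain \<alpha> \<beta> where \<alpha>\<beta>: "hom u v = line_point e q \<alpha> \<beta>" by blast
  define q' where "q' = u + e * v"
  define x y where "x = sn q' - sn q" and "y = cn q' - cn q"
  have eq: "line_point e q \<alpha> \<beta> = line_point e q' (cn v) (e * (dn u * sn v))"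
    using \<alpha>\<beta> hom_eq_line_point[OF e, of u v] by (simp add: q'_def)
  have \<alpha>: "\<alpha> = cn v" using arg_cong[OF eq, of snd] by simp
  have \<beta>: "\<beta> = e * (dn u * sn v)"
    using arg_cong[OF eq, of "\<lambda>h. fst h $ 3"] semi_axes_pos s_neq_0 e by auto
  have "\<beta> * cn q - \<alpha> * sn q = \<beta> * cn q' - \<alpha> * sn q'"
    using arg_cong[OF eq, of "\<lambda>h. fst h $ 1"] semi_axes_pos by (simp add: \<alpha> \<beta>)
  moreover have "\<alpha> * cn q + \<beta> * sn q = \<alpha> * cn q' + \<beta> * sn q'"
    using arg_cong[OF eq, of "\<lambda>h. fst h $ 2"] semi_axes_pos by (simp add: \<alpha> \<beta>)
  ultimately have 1: "\<beta> * y = \<alpha> * x" "\<alpha> * y = - (\<beta> * x)" by (simp_all add: x_def y_def algebra_simps)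
  \<comment> \<open>The two relations form a linear system for \<open>(x, y)\<close> whose
    determinant is, up to sign, the sum of the squares of \<alpha> and \<beta>.\<close>
  have "(\<alpha>\<^sup>2 + \<beta>\<^sup>2) * x = 0" "(\<alpha>\<^sup>2 + \<beta>\<^sup>2) * y = 0" using 1 by algebra+
  moreover have "\<alpha>\<^sup>2 + \<beta>\<^sup>2 \<noteq> 0"
  proof
    assume "\<alpha>\<^sup>2 + \<beta>\<^sup>2 = 0"
    then have "hom u v = 0" unfolding \<alpha>\<beta> by (simp add: line_point_def zero_prod_def)
    then show False using hom_nonzero by blast
  qed
  ultimately have "x = 0" "y = 0" by auto
  then show "\<exists>n::int. u + e * v = q + 4 * K * of_int n"
    using sn_cn_eq_iff[of q' q] by (simp add: x_def y_def q'_def)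
qed

text \<open>By \<open>ex_hom_of_cone\<close> every point of the projective line is some
  \<open>hom u v\<close> with reduced arguments, and \<open>on_line_iff\<close> turns incidence into
  the congruence modulo \<open>4 * K\<close>. Points with nonzero \<alpha> are finite;
  \<open>\<alpha> = 0\<close> gives the single ideal point.\<close>

lemma generator_image:
  assumes e: "e = 1 \<or> e = - 1"
  shows "generator_closure a b c
    (Z_map a b c m s ` {(u, v). u \<in> {- K..<3 * K} \<and> v \<in> {- K..<K} \<and> (\<exists>n::int. u + e * v = q + 4 * K * of_int n)})"
    (is "generator_closure a b c ?L")
proof -
  have e2: "e\<^sup>2 = 1" using e by auto
  let ?p = "line_base q" and ?d = "line_dir e q"
  have d: "?d \<noteq> 0"
  proof
    assume "?d = 0"
    then have "?d $ 3 = 0" by simp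
    then show False using e semi_axes_pos s_neq_0 by (auto simp: line_dir_def)
  qed
  have fin: "finite_point (?p + t *\<^sub>R ?d) = span {line_point e q 1 t}" for t
    by (simp add: finite_point_def line_point_def)
  have idl: "ideal_point ?d = span {line_point e q 0 1}"
    by (simp add: ideal_point_def line_point_def)
  have hyp: "?p + t *\<^sub>R ?d \<in> hyperboloid a b c" for t
    using line_point_on_cone[OF e2, of q 1 t] by (simp add: hyperboloid_def line_point_def)
  have mem: "span {line_point e q \<alpha> \<beta>} \<in> ?L" if nz: "line_point e q \<alpha> \<beta> \<noteq> 0" for \<alpha> \<beta>
  proof -
    obtain u v r where *: "u \<in> {- K..<3 * K}" "v \<in> {- K..<K}" "r \<noteq> 0" "line_point e q \<alpha> \<beta> = r *\<^sub>R hom u v"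
      using ex_hom_of_cone[of "fst (line_point e q \<alpha> \<beta>)" "snd (line_point e q \<alpha> \<beta>)"]
        nz line_point_on_cone[OF e2, of q \<alpha> \<beta>] unfolding prod.collapse by metis
    then have "hom u v = (1 / r) *\<^sub>R line_point e q \<alpha> \<beta>" by simp
    also have "\<dots> = line_point e q (\<alpha> / r) (\<beta> / r)" by (simp add: line_point_def algebra_simps)
    finally have "\<exists>n::int. u + e * v = q + 4 * K * of_int n" using on_line_iff[OF e] by blast
    moreover have "span {line_point e q \<alpha> \<beta>} = Z_map a b c m s (u, v)"
      using * by (simp add: Z_map_eq span_singleton_scaleR)
    ultimately show ?thesis using * by auto
  qed
  have "?L = range (\<lambda>t. finite_point (?p + t *\<^sub>R ?d)) \<union> {ideal_point ?d}"
  proof (intro equalityI subsetI)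
    fix P assume "P \<in> ?L"
    then obtain u v where P: "P = span {hom u v}" and "\<exists>n::int. u + e * v = q + 4 * K * of_int n"
      by (auto simp: Z_map_eq)
    then obtain \<alpha> \<beta> where \<alpha>\<beta>: "hom u v = line_point e q \<alpha> \<beta>" using on_line_iff[OF e] by blast
    show "P \<in> range (\<lambda>t. finite_point (?p + t *\<^sub>R ?d)) \<union> {ideal_point ?d}"
    proof (cases "\<alpha> = 0")
      case True
      then have "hom u v = \<beta> *\<^sub>R line_point e q 0 1" by (simp add: \<alpha>\<beta> line_point_def)
      moreover from this have "\<beta> \<noteq> 0" using hom_nonzero[of u v] by auto
      ultimately show ?thesis by (simp add: P idl span_singleton_scaleR)
    next
      case False
      then have "hom u v = \<alpha> *\<^sub>R line_point e q 1 (\<beta> / \<alpha>)" by (simp add: \<alpha>\<beta> line_point_def algebra_simps)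
      then have "P = finite_point (?p + (\<beta> / \<alpha>) *\<^sub>R ?d)" using False by (simp add: P fin span_singleton_scaleR)
      then show ?thesis by blast
    qed
  next
    fix P assume "P \<in> range (\<lambda>t. finite_point (?p + t *\<^sub>R ?d)) \<union> {ideal_point ?d}"
    then consider t where "P = span {line_point e q 1 t}" | "P = span {line_point e q 0 1}"
      unfolding fin idl by blast
    then show "P \<in> ?L"
    proof cases
      case 1
      moreover have "line_point e q 1 t \<noteq> 0" by (simp add: line_point_def zero_prod_def)
      ultimately show ?thesis using mem[of 1 t] by simp
    next
      case 2
      then show ?thesis using mem[of 0 1] d by (simp add: line_point_def zero_prod_def)
    qed
  qed
  then show ?thesis unfolding generator_closure_def using d hyp by blast
qed

section \<open>Lines of curvature\<close>

abbreviation "W v \<equiv> B\<^sup>2 * (sn v)\<^sup>2 + c\<^sup>2 * (cn v)\<^sup>2"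

lemma W_pos: "0 < W v"
proof -
  have "W v = (B\<^sup>2 - c\<^sup>2) * (sn v)\<^sup>2 + c\<^sup>2" unfolding sn_cn_sq by algebra
  moreover have "0 \<le> (B\<^sup>2 - c\<^sup>2) * (sn v)\<^sup>2" using c_sq_less by simp
  ultimately show ?thesis using semi_axes_pos by (simp add: add_nonneg_pos)
qed

text \<open>The radicand is \<open>k1 - k2\<close> with \<open>k1 = - c^2\<close>; likewise
  \<open>W v\<close> is \<open>(cn v)^2 * (k0 - k1)\<close> at finite points.\<close>

definition \<kappa> :: "real \<Rightarrow> real" where
  "\<kappa> u = a * b * c / sqrt (A\<^sup>2 * (dn u)\<^sup>2 - c\<^sup>2)"

text \<open>The length of the normal vector splits into a factor in \<open>u\<close> and a factor in
  \<open>v\<close>. Hence along \<open>u = const\<close> each component of the unit normal is a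
  constant times a quotient by \<open>sqrt (W v)\<close>.\<close>

lemma hyperboloid_normal_Z_affine:
  assumes "0 < cn v"
  shows "hyperboloid_normal a b c (Z_affine a b c m s u v) = vector
    [- (\<kappa> u * sn u / a) * (dn v / sqrt (W v)), \<kappa> u * cn u / b * (1 / sqrt (W v)),
     - (\<kappa> u * s * dn u / c) * (sn v / sqrt (W v))]"
proof -
  \<comment> \<open>The vector normalized in \<open>hyperboloid_normal\<close>, multiplied by
    \<open>cn v\<close>, a positive factor that \<open>sgn\<close> ignores.\<close>
  let ?w = "vector [- (sn u * dn v / a), cn u / b, - (s * dn u * sn v / c)] :: real^3"
  have "(sn u * dn v / a)\<^sup>2 + (cn u / b)\<^sup>2 + (s * dn u * sn v / c)\<^sup>2 =
    (b\<^sup>2 * c\<^sup>2 * ((sn u)\<^sup>2 * (dn v)\<^sup>2) + a\<^sup>2 * c\<^sup>2 * (cn u)\<^sup>2 + a\<^sup>2 * b\<^sup>2 * ((dn u)\<^sup>2 * (sn v)\<^sup>2)) / (a * b * c)\<^sup>2"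
    using semi_axes_pos by (simp add: power_divide power_mult_distrib s_sq field_simps)
  also have "b\<^sup>2 * c\<^sup>2 * ((sn u)\<^sup>2 * (dn v)\<^sup>2) + a\<^sup>2 * c\<^sup>2 * (cn u)\<^sup>2 + a\<^sup>2 * b\<^sup>2 * ((dn u)\<^sup>2 * (sn v)\<^sup>2)
    = (A\<^sup>2 * (dn u)\<^sup>2 - c\<^sup>2) * W v"
    unfolding dn_sq sn_cn_sq a_sq b_sq using m_sq by algebra
  finally have "norm ?w = sqrt (A\<^sup>2 * (dn u)\<^sup>2 - c\<^sup>2) * sqrt (W v) / (a * b * c)"
    using semi_axes_pos by (simp add: norm_vector3 real_sqrt_divide real_sqrt_mult)
  then have n: "inverse (norm ?w) = \<kappa> u / sqrt (W v)"
    by (simp add: \<kappa>_def field_simps)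
  have "hyperboloid_normal a b c (Z_affine a b c m s u v) = sgn ((1 / cn v) *\<^sub>R ?w)"
    unfolding hyperboloid_normal_def using semi_axes_pos assms
    by (intro arg_cong[where f = sgn]) (simp add: Z_affine_def vec_eq_iff forall_3 power2_eq_square field_simps)
  also have "\<dots> = inverse (norm ?w) *\<^sub>R ?w"
    using assms by (simp add: sgn_scaleR sgn_div_norm inverse_eq_divide)
  also have "\<dots> = vector
    [- (\<kappa> u * sn u / a) * (dn v / sqrt (W v)), \<kappa> u * cn u / b * (1 / sqrt (W v)),
     - (\<kappa> u * s * dn u / c) * (sn v / sqrt (W v))]"
    unfolding n by (simp add: vec_eq_iff forall_3)
  finally show ?thesis .
qed

lemma Z_affine_deriv:
  assumes "cn v \<noteq> 0"
  shows "((\<lambda>v. Z_affine a b c m s u v) has_vector_derivative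
    vector [- a * (sn u * (sn v * (1 - m\<^sup>2) / (cn v)\<^sup>2)), b * (cn u * (sn v * dn v / (cn v)\<^sup>2)),
      s * c * (dn u * (dn v / (cn v)\<^sup>2))]) (at v)"
proof -
  note eqs = sn_cn_sq[of v] dn_sq[of v]
  have "((\<lambda>v. dn v / cn v) has_real_derivative sn v * (1 - m\<^sup>2) / (cn v)\<^sup>2) (at v)"
  proof (rule DERIV_cong)
    show "((\<lambda>v. dn v / cn v) has_real_derivative
      (- (m\<^sup>2 * sn v * cn v) * cn v - dn v * (- (sn v * dn v))) / (cn v * cn v)) (at v)"
      by (intro DERIV_divide sn_deriv cn_deriv dn_deriv assms)
    have "- (m\<^sup>2 * sn v * cn v) * cn v - dn v * (- (sn v * dn v)) = sn v * (1 - m\<^sup>2)"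
      using eqs by algebra
    then show "(- (m\<^sup>2 * sn v * cn v) * cn v - dn v * (- (sn v * dn v))) / (cn v * cn v) = sn v * (1 - m\<^sup>2) / (cn v)\<^sup>2"
      by (simp add: power2_eq_square)
  qed
  moreover have "((\<lambda>v. 1 / cn v) has_real_derivative sn v * dn v / (cn v)\<^sup>2) (at v)"
    using DERIV_divide[OF DERIV_const cn_deriv assms, of 1] by (simp add: power2_eq_square)
  moreover have "((\<lambda>v. sn v / cn v) has_real_derivative dn v / (cn v)\<^sup>2) (at v)"
  proof (rule DERIV_cong)
    show "((\<lambda>v. sn v / cn v) has_real_derivative
      (cn v * dn v * cn v - sn v * (- (sn v * dn v))) / (cn v * cn v)) (at v)"
      by (intro DERIV_divide sn_deriv cn_deriv dn_deriv assms)
    have "cn v * dn v * cn v - sn v * (- (sn v * dn v)) = dn v"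
      using eqs by algebra
    then show "(cn v * dn v * cn v - sn v * (- (sn v * dn v))) / (cn v * cn v) = dn v / (cn v)\<^sup>2"
      by (simp add: power2_eq_square)
  qed
  ultimately have "((\<lambda>v. vector [- a * (sn u * (dn v / cn v)), b * (cn u * (1 / cn v)), s * c * (dn u * (sn v / cn v))] :: real^3)
    has_vector_derivative
    vector [- a * (sn u * (sn v * (1 - m\<^sup>2) / (cn v)\<^sup>2)), b * (cn u * (sn v * dn v / (cn v)\<^sup>2)),
      s * c * (dn u * (dn v / (cn v)\<^sup>2))]) (at v)"
    by (intro has_vector_derivative_vector3 DERIV_cmult)
  then show ?thesis by (simp add: Z_affine_def[abs_def])
qed

text \<open>Quotient rule, where \<open>b^2 * sn v * cn v * dn v\<close> is half the derivative of
  \<open>W\<close>.\<close>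

lemma div_sqrt_W_deriv:
  assumes "(f has_real_derivative f') (at v)"
  shows "((\<lambda>v. f v / sqrt (W v)) has_real_derivative
     (f' * W v - f v * (b\<^sup>2 * sn v * cn v * dn v)) / (W v * sqrt (W v))) (at v)"
proof -
  have W: "(W has_real_derivative 2 * (b\<^sup>2 * sn v * cn v * dn v)) (at v)"
    apply (rule derivative_eq_intros sn_deriv cn_deriv refl)+
    by (simp add: b_sq algebra_simps)
  have sW: "((\<lambda>v. sqrt (W v)) has_real_derivative (b\<^sup>2 * sn v * cn v * dn v) / sqrt (W v)) (at v)"
    using DERIV_chain2[OF DERIV_real_sqrt[OF W_pos] W] by (simp add: field_simps)
  have "((\<lambda>v. f v / sqrt (W v)) has_real_derivative
      (f' * sqrt (W v) - f v * ((b\<^sup>2 * sn v * cn v * dn v) / sqrt (W v))) / (sqrt (W v) * sqrt (W v))) (at v)"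
    using W_pos[of v] by (intro DERIV_divide assms sW) simp
  moreover have "(x * r - y / r) / (r * r) = (x * (r * r) - y) / (r * r * r)" if "0 < r" for x y r :: real
    using that by (simp add: field_simps)
  from this[of "sqrt (W v)"] have "(f' * sqrt (W v) - f v * ((b\<^sup>2 * sn v * cn v * dn v) / sqrt (W v))) / (sqrt (W v) * sqrt (W v))
    = (f' * W v - f v * (b\<^sup>2 * sn v * cn v * dn v)) / (W v * sqrt (W v))"
    using W_pos[of v] by simp
  ultimately show ?thesis by (simp only:)
qed

lemma line_of_curvature_Z_affine: "line_of_curvature a b c (Z_affine a b c m s u) {- K<..<K}"
  unfolding line_of_curvature_def
proof (intro ballI conjI)
  fix v assume v: "v \<in> {- K<..<K}"
  then have cn: "0 < cn v" using cn_pos by simp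
  then show "Z_affine a b c m s u v \<in> hyperboloid a b c" using Z_affine_in_hyperboloid by simp
  let ?g = "vector [- a * (sn u * (sn v * (1 - m\<^sup>2) / (cn v)\<^sup>2)), b * (cn u * (sn v * dn v / (cn v)\<^sup>2)),
      s * c * (dn u * (dn v / (cn v)\<^sup>2))] :: real^3"
  let ?n = "\<lambda>v. vector
    [- (\<kappa> u * sn u / a) * (dn v / sqrt (W v)), \<kappa> u * cn u / b * (1 / sqrt (W v)),
     - (\<kappa> u * s * dn u / c) * (sn v / sqrt (W v))] :: real^3"
  define R where "R = W v * sqrt (W v)"
  \<comment> \<open>Read off from the third component, where the derivative of the curve never
    vanishes; the other two components obey the same ratio.\<close>
  define \<mu> where "\<mu> = - \<kappa> u * (cn v)^3 / R"
  have R: "0 < R" using W_pos[of v] by (simp add: R_def)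
  note eqs = sn_cn_sq[of v] dn_sq[of v]
  have W: "W v = c\<^sup>2 + b\<^sup>2 * (sn v)\<^sup>2" unfolding b_sq sn_cn_sq by algebra
  have "- (m\<^sup>2 * sn v * cn v) * W v - dn v * (b\<^sup>2 * sn v * cn v * dn v) = - (a\<^sup>2 * (1 - m\<^sup>2) * sn v * cn v)"
    using eqs m_sq unfolding a_sq b_sq by algebra
  then have d1: "((\<lambda>v. dn v / sqrt (W v)) has_real_derivative
      - (a\<^sup>2 * (1 - m\<^sup>2) * sn v * cn v) / (W v * sqrt (W v))) (at v)"
    using div_sqrt_W_deriv[OF dn_deriv, of v] by (simp only:)
  have d2: "((\<lambda>v. 1 / sqrt (W v)) has_real_derivative - (b\<^sup>2 * sn v * cn v * dn v) / (W v * sqrt (W v))) (at v)"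
    using div_sqrt_W_deriv[OF DERIV_const, of 1] by simp
  have "cn v * dn v * W v - sn v * (b\<^sup>2 * sn v * cn v * dn v) = c\<^sup>2 * cn v * dn v"
    unfolding W by algebra
  then have d3: "((\<lambda>v. sn v / sqrt (W v)) has_real_derivative c\<^sup>2 * cn v * dn v / (W v * sqrt (W v))) (at v)"
    using div_sqrt_W_deriv[OF sn_deriv, of v] by (simp only:)
  have "(?n has_vector_derivative vector
    [- (\<kappa> u * sn u / a) * (- (a\<^sup>2 * (1 - m\<^sup>2) * sn v * cn v) / R),
     \<kappa> u * cn u / b * (- (b\<^sup>2 * sn v * cn v * dn v) / R),
     - (\<kappa> u * s * dn u / c) * (c\<^sup>2 * cn v * dn v / R)]) (at v)"
    by (intro has_vector_derivative_vector3 DERIV_cmult d1[folded R_def] d2[folded R_def] d3[folded R_def])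
  also have "vector
    [- (\<kappa> u * sn u / a) * (- (a\<^sup>2 * (1 - m\<^sup>2) * sn v * cn v) / R),
     \<kappa> u * cn u / b * (- (b\<^sup>2 * sn v * cn v * dn v) / R),
     - (\<kappa> u * s * dn u / c) * (c\<^sup>2 * cn v * dn v / R)] = \<mu> *\<^sub>R ?g"
    using semi_axes_pos cn R by (simp add: vec_eq_iff forall_3 \<mu>_def field_simps power2_eq_square power3_eq_cube)
  finally have "(?n has_vector_derivative \<mu> *\<^sub>R ?g) (at v)" .
  then have "((\<lambda>x. hyperboloid_normal a b c (Z_affine a b c m s u x)) has_vector_derivative \<mu> *\<^sub>R ?g) (at v)"
    by (rule has_vector_derivative_transform_within_open[where S = "{- K<..<K}"])
      (use v cn_pos hyperboloid_normal_Z_affine in auto)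
  moreover have "?g \<noteq> 0"
  proof
    assume "?g = 0"
    then have "?g $ 3 = 0" by simp
    then show False using semi_axes_pos s_neq_0 dn_pos[of u] dn_pos[of v] cn by simp
  qed
  ultimately show "\<exists>\<gamma>' \<mu>. \<gamma>' \<noteq> 0 \<and> (Z_affine a b c m s u has_vector_derivative \<gamma>') (at v) \<and>
      ((\<lambda>x. hyperboloid_normal a b c (Z_affine a b c m s u x)) has_vector_derivative \<mu> *\<^sub>R \<gamma>') (at v)"
    using Z_affine_deriv[of v u] cn by auto
qed

section \<open>Branches of the curves of constant k2\<close>

lemma has_k2_Z_affine_iff:
  assumes "v \<in> {- K<..<K}"
  shows "has_k2 A B (finite_point (Z_affine a b c m s u' v)) (ereal (- (A\<^sup>2 * (dn u)\<^sup>2)))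
    \<longleftrightarrow> A\<^sup>2 * (dn u')\<^sup>2 = A\<^sup>2 * (dn u)\<^sup>2"
proof -
  have eq: "finite_point (Z_affine a b c m s u' v) = span {hom u' v}"
    using Z_map_finite[of v u'] Z_map_eq[of u' v] cn_pos[of v] assms by simp
  show ?thesis unfolding eq using has_k2_hom[of u' v] limit_value_unique[OF hom_nonzero[of u' v]]
    unfolding has_k2_def by fastforce
qed

text \<open>On the hyperboloid the value of \<open>k2\<close> fixes \<open>sn\<close> and
  \<open>cn\<close> of the first parameter up to sign. A connected set with points of opposite signs
  would meet the plane \<open>x = 0\<close> or \<open>y = 0\<close>, but a nonzero
  \<open>sn u\<close> or \<open>cn u\<close> keeps the whole level set off that plane.\<close>

lemma Z_affine_component:
  "Z_affine a b c m s u ` {- K<..<K}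
    \<in> components {p \<in> hyperboloid a b c. has_k2 A B (finite_point p) (ereal (- (A\<^sup>2 * (dn u)\<^sup>2)))}"
    (is "?C \<in> components ?S")
  unfolding in_components_maximal
proof (intro conjI allI impI)
  show "?C \<noteq> {}" using K_pos by simp
  show "?C \<subseteq> ?S"
    using has_k2_Z_affine_iff Z_affine_in_hyperboloid cn_pos by force
  have "continuous_on {- K<..<K} (Z_affine a b c m s u)"
    using Z_affine_deriv cn_pos
    by (intro continuous_at_imp_continuous_on) (fastforce intro: has_vector_derivative_continuous)
  then show "connected ?C" by (intro connected_continuous_image) auto
  fix D assume D: "D \<noteq> {} \<and> ?C \<subseteq> D \<and> D \<subseteq> ?S \<and> connected D"
  have rep: "\<exists>u' v. v \<in> {- K<..<K} \<and> p = Z_affine a b c m s u' v \<and> (sn u')\<^sup>2 = (sn u)\<^sup>2" if "p \<in> D" for p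
  proof -
    have p: "p \<in> ?S" using that D by blast
    then obtain u' v where *: "v \<in> {- K<..<K}" "p = Z_affine a b c m s u' v"
      using hyperboloid_eq_Z_affine by blast
    then have "A\<^sup>2 * (dn u')\<^sup>2 = A\<^sup>2 * (dn u)\<^sup>2" using p has_k2_Z_affine_iff by blast
    then show ?thesis using * k2_eqD(2) by blast
  qed
  \<comment> \<open>Reference point of the branch; its first two coordinates,
    \<open>- a * sn u\<close> and \<open>b * cn u\<close>, are compared in sign with those of
    \<open>p\<close>.\<close>
  have Z0: "Z_affine a b c m s u 0 \<in> D" using D K_pos by force
  have "p \<in> ?C" if p: "p \<in> D" for p
  proof -
    obtain u' v where *: "v \<in> {- K<..<K}" "p = Z_affine a b c m s u' v" "(sn u')\<^sup>2 = (sn u)\<^sup>2"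
      using rep[OF p] by blast
    have cn: "0 < cn v" using * cn_pos by simp
    have crossing: "\<exists>z\<in>D. z $ i = 0" if "p $ i * Z_affine a b c m s u 0 $ i < 0" for i
    proof (cases "p $ i < 0")
      case True
      then show ?thesis using that D p Z0
        by (intro connected_ivt_component_cart[of D p "Z_affine a b c m s u 0" i 0]) (auto simp: mult_less_0_iff)
    next
      case False
      then show ?thesis using that D p Z0
        by (intro connected_ivt_component_cart[of D "Z_affine a b c m s u 0" p i 0]) (auto simp: mult_less_0_iff)
    qed
    have sn: "sn u' = sn u"
    proof (rule ccontr)
      assume ne: "sn u' \<noteq> sn u"
      then have neg: "sn u' = - sn u" "sn u \<noteq> 0" using *(3) by (auto simp: power2_eq_iff)
      have "p $ 1 * Z_affine a b c m s u 0 $ 1 = - ((a * sn u)\<^sup>2 * (dn v / cn v))"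
        by (simp add: *(2) Z_affine_def neg(1) power2_eq_square)
      also have "\<dots> < 0" using cn dn_pos[of v] semi_axes_pos neg(2) by simp
      finally obtain z where z: "z \<in> D" "z $ 1 = 0" using crossing by blast
      obtain u'' v'' where **: "v'' \<in> {- K<..<K}" "z = Z_affine a b c m s u'' v''" "(sn u'')\<^sup>2 = (sn u)\<^sup>2"
        using rep[OF z(1)] by blast
      then show False using z(2) neg(2) cn_pos[of v''] dn_pos[of v''] semi_axes_pos by (simp add: Z_affine_def)
    qed
    have cn': "cn u' = cn u"
    proof (rule ccontr)
      assume ne: "cn u' \<noteq> cn u"
      have "(cn u')\<^sup>2 = (cn u)\<^sup>2" using *(3) by (simp add: sn_cn_sq)
      then have neg: "cn u' = - cn u" "cn u \<noteq> 0" using ne by (auto simp: power2_eq_iff)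
      have "p $ 2 * Z_affine a b c m s u 0 $ 2 = - ((b * cn u)\<^sup>2 * (1 / cn v))"
        by (simp add: *(2) Z_affine_def neg(1) power2_eq_square)
      also have "\<dots> < 0" using cn semi_axes_pos neg(2) by simp
      finally obtain z where z: "z \<in> D" "z $ 2 = 0" using crossing by blast
      obtain u'' v'' where **: "v'' \<in> {- K<..<K}" "z = Z_affine a b c m s u'' v''" "(sn u'')\<^sup>2 = (sn u)\<^sup>2"
        using rep[OF z(1)] by blast
      then have "(cn u'')\<^sup>2 = (cn u)\<^sup>2" by (simp add: sn_cn_sq)
      then show False using z(2) ** neg(2) cn_pos[of v''] semi_axes_pos by (simp add: Z_affine_def)
    qed
    have "p = Z_affine a b c m s u v" by (simp add: *(2) Z_affine_def sn cn' jacobi_dn_def)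
    then show ?thesis using *(1) by blast
  qed
  then show "D = ?C" using D by blast
qed

end

theorem theorem13:
  fixes a_c b_c k1 a b c m K s :: real
    and U V :: "real set"
  assumes "a_c > b_c" and "b_c > 0"
    and "- (b_c^2) < k1" and "k1 < 0"
    and "a = sqrt (a_c^2 + k1)" and "b = sqrt (b_c^2 + k1)" and "c = sqrt (- k1)"
    and "m = sqrt (a_c^2 - b_c^2) / a_c"
    and "K = ell_K m"
    and "U = {- K ..< 3 * K}" and "V = {- K ..< K}"
    and "s = 1 \<or> s = -1"
  shows
   "(inj_on (Z_map a b c m s) (U \<times> V)) \<and>
    (Z_map a b c m s ` (U \<times> V) = hyperboloid_closure a b c) \<and>
    (Z_map a b c m s ` (U \<times> {- K <..< K}) = finite_point ` hyperboloid a b c) \<and>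
    (\<forall>u\<in>U. \<exists>k2::real. - (a_c^2) \<le> k2 \<and> k2 \<le> - (b_c^2) \<and>
           (\<forall>v\<in>V. has_k2 a_c b_c (Z_map a b c m s (u, v)) (ereal k2)) \<and>
           Z_affine a b c m s u ` {- K <..< K}
             \<in> components {p \<in> hyperboloid a b c. has_k2 a_c b_c (finite_point p) (ereal k2)} \<and>
           line_of_curvature a b c (Z_affine a b c m s u) {- K <..< K}) \<and>
    (\<forall>v\<in>V. \<exists>k0::ereal. \<forall>u\<in>U. has_k0 a_c b_c (Z_map a b c m s (u, v)) k0) \<and>
    (\<forall>q::real. generator_closure a b c
           (Z_map a b c m s ` {(u, v). u \<in> U \<and> v \<in> V \<and> (\<exists>n::int. u + v = q + 4 * K * of_int n)})) \<and>
    (\<forall>q::real. generator_closure a b c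
           (Z_map a b c m s ` {(u, v). u \<in> U \<and> v \<in> V \<and> (\<exists>n::int. u - v = q + 4 * K * of_int n)}))"
proof -
  have "b_c\<^sup>2 < a_c\<^sup>2" using assms(1,2) by (simp add: power_strict_mono)
  have ac: "0 < a_c" using assms(1,2) by simp
  have pos: "0 < a" "0 < b" "0 < c"
    using assms(3-7) \<open>b_c\<^sup>2 < a_c\<^sup>2\<close> by simp_all
  have sq: "a\<^sup>2 = a_c\<^sup>2 + k1" "b\<^sup>2 = b_c\<^sup>2 + k1" "c\<^sup>2 = - k1"
    using assms(3-7) \<open>b_c\<^sup>2 < a_c\<^sup>2\<close> by simp_all
  have "m\<^sup>2 * a_c\<^sup>2 = a_c\<^sup>2 - b_c\<^sup>2"
    using assms(8) \<open>b_c\<^sup>2 < a_c\<^sup>2\<close> ac by (simp add: power_divide)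
  moreover have "s\<^sup>2 = 1" using assms(12) by auto
  \<comment> \<open>The parameter \<open>k1\<close> enters as \<open>- c^2\<close>, so that
    \<open>a_c^2 + k1\<close> takes the form \<open>A^2 - c^2\<close> of the locale.\<close>
  ultimately interpret confocal_hyperboloid a_c b_c a b c m s
    using assms(1,2) pos sq by unfold_locales simp_all
  note K = assms(9) and U = assms(10) and V = assms(11)
  show ?thesis
    unfolding U V K
  proof (intro conjI ballI allI)
    fix u
    show "\<exists>k2. - a_c\<^sup>2 \<le> k2 \<and> k2 \<le> - b_c\<^sup>2 \<and>
           (\<forall>v\<in>{- ell_K m..<ell_K m}. has_k2 a_c b_c (Z_map a b c m s (u, v)) (ereal k2)) \<and>
           Z_affine a b c m s u ` {- ell_K m<..<ell_K m}
             \<in> components {p \<in> hyperboloid a b c. has_k2 a_c b_c (finite_point p) (ereal k2)} \<and>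
           line_of_curvature a b c (Z_affine a b c m s u) {- ell_K m<..<ell_K m}"
      using k2_bounds[of u] has_k2_hom[of u] Z_affine_component[of u] line_of_curvature_Z_affine[of u]
      by (intro exI[of _ "- (a_c\<^sup>2 * (dn u)\<^sup>2)"]) (simp add: Z_map_eq)
  next
    fix v
    show "\<exists>k0. \<forall>u\<in>{- ell_K m..<3 * ell_K m}. has_k0 a_c b_c (Z_map a b c m s (u, v)) k0"
      unfolding Z_map_eq using has_k0_hom by blast
  next
    fix q
    show "generator_closure a b c (Z_map a b c m s ` {(u, v). u \<in> {- ell_K m..<3 * ell_K m} \<and>
        v \<in> {- ell_K m..<ell_K m} \<and> (\<exists>n::int. u + v = q + 4 * ell_K m * of_int n)})"
      using generator_image[of 1 q] by simp
    show "generator_closure a b c (Z_map a b c m s ` {(u, v). u \<in> {- ell_K m..<3 * ell_K m} \<and>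
        v \<in> {- ell_K m..<ell_K m} \<and> (\<exists>n::int. u - v = q + 4 * ell_K m * of_int n)})"
      using generator_image[of "- 1" q] by simp
  qed (fact inj_on_Z_map Z_map_image Z_map_finite_image)+
qed

end
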